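(* Let $p\in[1,\infty)$. For any decreasing function $\Lambda:\mathbb R\to[0,1]$, the following are equivalent: (i) the risk measure $\mathrm{EVaR}^p_\Lambda$ on $L^p$ is convex; (ii) the risk measure $\mathrm{EVaR}^p_\Lambda$ is concave in mixtures; (iii) the risk measure $\mathrm{EVaR}^p_\Lambda$ is cash additive; (iv) the function $\Lambda$ is constant on $\mathbb R$.
   Context: $(\Omega,\mathcal F,\mathbb P)$ is an atomless probability space, $L^p=L^p(\Omega,\mathcal F,\mathbb P)$, $\overline{\mathbb R}=[-\infty,\infty]$. "Increasing" and "decreasing" are meant in the weak (non-strict) sense. Let $p\in[1,\infty)$ and $q\in(1,\infty]$ with $1/p+1/q=1$. Rényi entropy: for a probability measure $\mathbb Q\ll\mathbb P$, $H_q(d\mathbb Q/d\mathbb P)=\frac1{q-1}\log\mathbb E[(d\mathbb Q/d\mathbb P)^q]$ if $q\in(1,\infty)$, and $H_\infty(d\mathbb Q/d\mathbb P)=\log\|d\mathbb Q/d\mathbb P\|_\infty$; $H_q=\infty$ if these are not finite or if $\mathbb Q\not\ll\mathbb P$. Rényi entropic value-at-risk: for $X\in L^p$ and $\alpha\in[0,1)$, $\mathrm{EVaR}^p_\alpha(X)=\sup\{\mathbb E_{\mathbb Q}[X]: H_q(d\mathbb Q/d\mathbb P)\le\log\frac1{1-\alpha}\}$; and $\mathrm{EVaR}^p_1(X)=\operatorname{ess\,sup}(X)$. Lambda version, for decreasing $\Lambda:\mathbb R\to[0,1]$: $\mathrm{EVaR}^p_\Lambda:L^p\to\overline{\mathbb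 R}$, $\mathrm{EVaR}^p_\Lambda(X)=\sup_{x\in\mathbb R}\min\{\mathrm{EVaR}^p_{\Lambda(x)}(X),x\}$. A functional $\rho$ on $L^p$ is convex if $\rho(\lambda X+(1-\lambda)Y)\le\lambda\rho(X)+(1-\lambda)\rho(Y)$ for all $X,Y\in L^p$, $\lambda\in[0,1]$ (with $0\cdot\infty=0$); cash additive if $\rho(X+m)=\rho(X)+m$ for all $X\in L^p$, $m\in\mathbb R$. Let $\mathcal M_c(\mathbb R)$ be the set of compactly supported distributions on $\mathbb R$. A functional $\rho$ depending only on the distribution of its argument is concave in mixtures if $F\mapsto\rho(X_F)$ is concave on $\mathcal M_c(\mathbb R)$, where $X_F$ has distribution $F$, i.e. $\rho(X_{\lambda F+(1-\lambda)G})\ge\lambda\rho(X_F)+(1-\lambda)\rho(X_G)$ for all $F,G\in\mathcal M_c(\mathbb R)$, $\lambda\in[0,1]$. *)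

theory Defs
  imports "HOL-Probability.Probability" "HOL-Probability.Essential_Supremum"
begin

definition atomless :: "'a measure \<Rightarrow> bool" where
  "atomless M \<longleftrightarrow>
     (\<forall>A\<in>sets M. emeasure M A > 0 \<longrightarrow>
        (\<exists>B\<in>sets M. B \<subseteq> A \<and> 0 < emeasure M B \<and> emeasure M B < emeasure M A))"

text \<open>Elements of \<open>L\<^sup>p\<close> are represented by functions, not by almost-everywhere classes.\<close>

definition Lp :: "real \<Rightarrow> 'a measure \<Rightarrow> ('a \<Rightarrow> real) set" where
  "Lp p M = {X \<in> borel_measurable M. integrable M (\<lambda>\<omega>. \<bar>X \<omega>\<bar> powr p)}"

text \<open>\<open>enn2real\<close> changes the Radon-Nikodym derivative of a probability measure on a null set
  only. The case distinctions on infinite values keep the junk value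
  \<open>real_of_ereal \<infinity> = 0\<close> out of the logarithm.\<close>

definition renyi_entropy :: "ereal \<Rightarrow> 'a measure \<Rightarrow> 'a measure \<Rightarrow> ereal" where
  "renyi_entropy q M Q =
     (let Z = (\<lambda>\<omega>. enn2real (RN_deriv M Q \<omega>)) in
      if \<not> absolutely_continuous M Q then \<infinity>
      else if q = \<infinity> then
        (let N = esssup M (\<lambda>\<omega>. ereal \<bar>Z \<omega>\<bar>) in
         if N = \<infinity> then \<infinity> else ereal (ln (real_of_ereal N)))
      else
        (let r = real_of_ereal q; E = (\<integral>\<^sup>+\<omega>. ennreal (Z \<omega> powr r) \<partial>M) in
         if E = \<infinity> then \<infinity> else ereal (1 / (r - 1) * ln (enn2real E))))"

text \<open>The functionals below are indexed by the exponent \<open>q\<close> conjugate to \<open>p\<close>. The Bochner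
  integral of \<open>X \<in> L\<^sup>p\<close> with respect to \<open>Q\<close> never takes its default value here: finite
  entropy of order \<open>q\<close> puts \<open>dQ/dP\<close> in \<open>L\<^sup>q\<close>, so \<open>X\<close> is \<open>Q\<close>-integrable.\<close>

definition EVaR :: "ereal \<Rightarrow> 'a measure \<Rightarrow> real \<Rightarrow> ('a \<Rightarrow> real) \<Rightarrow> ereal" where
  "EVaR q M \<alpha> X =
     (if \<alpha> = 1 then esssup M (\<lambda>\<omega>. ereal (X \<omega>))
      else (SUP Q \<in> {Q. prob_space Q \<and> sets Q = sets M
                        \<and> renyi_entropy q M Q \<le> ereal (ln (1 / (1 - \<alpha>)))}.
              ereal (integral\<^sup>L Q X)))"

definition Lambda_EVaR ::
    "ereal \<Rightarrow> 'a measure \<Rightarrow> (real \<Rightarrow> real) \<Rightarrow> ('a \<Rightarrow> real) \<Rightarrow> ereal" where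
  "Lambda_EVaR q M \<Lambda> X = (SUP x::real. min (EVaR q M (\<Lambda> x) X) (ereal x))"

text \<open>In \<open>ereal\<close>, \<open>0 * \<infinity> = 0\<close>. The sum \<open>\<infinity> + (-\<infinity>)\<close> does not arise for \<open>Lambda_EVaR\<close>, which is
  bounded below by the expectation.\<close>

definition convex_functional :: "real \<Rightarrow> 'a measure \<Rightarrow> (('a \<Rightarrow> real) \<Rightarrow> ereal) \<Rightarrow> bool" where
  "convex_functional p M \<rho> \<longleftrightarrow>
     (\<forall>X\<in>Lp p M. \<forall>Y\<in>Lp p M. \<forall>l\<in>{0..1}.
        \<rho> (\<lambda>\<omega>. l * X \<omega> + (1 - l) * Y \<omega>) \<le> ereal l * \<rho> X + ereal (1 - l) * \<rho> Y)"

definition cash_additive :: "real \<Rightarrow> 'a measure \<Rightarrow> (('a \<Rightarrow> real) \<Rightarrow> ereal) \<Rightarrow> bool" where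
  "cash_additive p M \<rho> \<longleftrightarrow>
     (\<forall>X\<in>Lp p M. \<forall>m::real. \<rho> (\<lambda>\<omega>. X \<omega> + m) = \<rho> X + ereal m)"

definition compact_distributions :: "real measure set" where
  "compact_distributions = {F. real_distribution F \<and> (\<exists>K. compact K \<and> emeasure F K = 1)}"

definition mixture :: "real \<Rightarrow> real measure \<Rightarrow> real measure \<Rightarrow> real measure" where
  "mixture l F G =
     measure_of UNIV (sets borel)
       (\<lambda>A. ennreal l * emeasure F A + ennreal (1 - l) * emeasure G A)"

text \<open>\<open>measure_of\<close> yields the zero measure if its argument is not a measure; this is
  not the case here.\<close>

lemma emeasure_mixture:
  assumes F: "sets F = sets borel" and G: "sets G = sets borel" and A: "A \<in> sets borel"
  shows "emeasure (mixture l F G) A = ennreal l * emeasure F A + ennreal (1 - l) * emeasure G A"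
proof -
  let ?m = "\<lambda>A. ennreal l * emeasure F A + ennreal (1 - l) * emeasure G A"
  have "countably_additive (sets borel) ?m"
  proof (rule countably_additiveI)
    fix B :: "nat \<Rightarrow> real set"
    assume B: "range B \<subseteq> sets borel" "disjoint_family B" "(\<Union>i. B i) \<in> sets borel"
    have "(\<Sum>i. emeasure F (B i)) = emeasure F (\<Union>i. B i)"
      by (rule suminf_emeasure) (use B F in auto)
    moreover have "(\<Sum>i. emeasure G (B i)) = emeasure G (\<Union>i. B i)"
      by (rule suminf_emeasure) (use B G in auto)
    ultimately show "(\<Sum>i. ?m (B i)) = ?m (\<Union>i. B i)"
      by (simp add: suminf_add[symmetric])
  qed
  moreover have "positive (sets borel) ?m" by (simp add: positive_def)
  ultimately show ?thesis
    using A unfolding mixture_def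
    by (intro emeasure_measure_of_sigma) (use sets.sigma_algebra_axioms[of borel] in auto)
qed

text \<open>For \<open>\<rho>\<close> depending only on the distribution of its argument, \<open>X\<close>, \<open>Y\<close> and \<open>Z\<close> below are the
  representatives \<open>X\<^sub>F\<close>, \<open>X\<^sub>G\<close> and \<open>X\<^sub>H\<close> with \<open>H = l F + (1 - l) G\<close>. They exist on an atomless
  space. Quantifying over all representatives avoids choosing one; it also forces \<open>\<rho>\<close> to depend
  only on the distribution on the random variables considered (take \<open>F = G\<close>).\<close>

definition concave_in_mixtures :: "real \<Rightarrow> 'a measure \<Rightarrow> (('a \<Rightarrow> real) \<Rightarrow> ereal) \<Rightarrow> bool" where
  "concave_in_mixtures p M \<rho> \<longleftrightarrow>
     (\<forall>F\<in>compact_distributions. \<forall>G\<in>compact_distributions. \<forall>l\<in>{0..1}.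
        \<forall>X\<in>Lp p M. \<forall>Y\<in>Lp p M. \<forall>Z\<in>Lp p M.
          distr M borel X = F \<longrightarrow> distr M borel Y = G \<longrightarrow> distr M borel Z = mixture l F G \<longrightarrow>
          ereal l * \<rho> X + ereal (1 - l) * \<rho> Y \<le> \<rho> Z)"

end

theory Submission
  imports Defs
begin

text \<open>Write \<open>\<rho>\<close> for the Lambda version. For constant \<open>\<Lambda>\<close> it is an EVaR, a supremum of
  expectations \<open>X \<mapsto> E[Z X]\<close> over densities \<open>Z\<close> bounded in \<open>L\<^sup>q\<close>, hence convex and cash additive. It is
  concave in mixtures because densities for \<open>X\<close> and \<open>Y\<close> combine into one for the mixture, whose
  \<open>L\<^sup>q\<close> bound follows from \<open>r t\<^bsup>r-1\<^esup> z \<le> z\<^bsup>r\<^esup> + (r - 1) t\<^bsup>r\<^esup>\<close>. Conversely, let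
  \<open>a < b\<close> with \<open>\<Lambda>(a) > \<Lambda>(b)\<close> and choose an event with \<open>1 - \<Lambda>(a) < P(A) < 1 - \<Lambda>(b)\<close>. Then the EVaR of
  \<open>1\<^sub>A\<close> is \<open>1\<close> at level \<open>\<Lambda>(a)\<close> but at most some \<open>t < 1\<close> at level \<open>\<Lambda>(b)\<close>, so that
  \<open>\<rho>(1\<^sub>A + a - 1) \<ge> a\<close> and \<open>\<rho>(1\<^sub>A + b - t) \<le> b\<close>. This contradicts cash additivity, and, with
  \<open>\<rho>(1\<^sub>A + n) \<le> n + 1\<close> for a suitable \<open>n\<close>, also convexity. Concavity in mixtures
  fails for mixtures of a two-point law with a point mass.\<close>

section \<open>Events of intermediate probability in an atomless space\<close>

text \<open>Countably many events of probability below \<open>d - c\<close> exhaust the space up to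
  a null set. Their partial unions grow to probability 1 in steps shorter than the interval, so they
  cannot jump over it.\<close>

lemma (in prob_space) exists_measure_between:
  assumes "atomless M" and "0 \<le> c" "c < d" "d \<le> 1"
  obtains A where "A \<in> events" "c < prob A" "prob A < d"
proof -
  \<comment> \<open>Of \<open>E\<close> and \<open>C - E\<close>, one has at most half the mass of
    \<open>C\<close>; iteration yields arbitrarily small events.\<close>
  have halve: "\<exists>C\<in>events. C \<subseteq> B \<and> 0 < prob C \<and> prob C \<le> prob B / 2 ^ n"
    if "B \<in> events" "0 < prob B" for B n
  proof (induction n)
    case 0
    then show ?case using that by auto
  next
    case (Suc n)
    then obtain C where C: "C \<in> events" "C \<subseteq> B" "0 < prob C" "prob C \<le> prob B / 2 ^ n" by auto
    then obtain E where E: "E \<in> events" "E \<subseteq> C" "0 < prob E" "prob E < prob C"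
      using assms(1) unfolding atomless_def emeasure_eq_measure
      by (metis ennreal_less_iff ennreal_less_zero_iff measure_nonneg)
    have D: "prob (C - E) = prob C - prob E" using finite_measure_Diff C E by auto
    show ?case
    proof (cases "prob E \<le> prob C / 2")
      case True
      then have "prob E \<le> prob B / 2 ^ Suc n" using C(4) by simp
      then show ?thesis using C E by (meson subset_trans)
    next
      case False
      then have "prob (C - E) \<le> prob B / 2 ^ Suc n" "0 < prob (C - E)" using C(4) E D by auto
      then show ?thesis using C E by (meson Diff_subset sets.Diff subset_trans)
    qed
  qed
  have small: "\<exists>C\<in>events. C \<subseteq> B \<and> 0 < prob C \<and> prob C < d - c"
    if B: "B \<in> events" "0 < prob B" for B
  proof -
    obtain n where n: "1 / (d - c) < 2 ^ n" using real_arch_pow[of 2 "1/(d-c)"] by auto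
    obtain C where C: "C\<in>events" "C \<subseteq> B" "0 < prob C" "prob C \<le> prob B / 2 ^ n"
      using halve[OF B] by blast
    have "prob B / 2 ^ n \<le> 1 / 2 ^ n" by (simp add: divide_right_mono)
    also have "\<dots> < d - c" using n assms by (simp add: field_simps)
    finally show ?thesis using C by (meson le_less_trans)
  qed
  \<comment> \<open>Exhaustion over countable rather than finite families, so that the supremum
    \<open>v\<close> is attained.\<close>
  define S where "S = {f :: nat \<Rightarrow> 'a set. \<forall>n. f n \<in> events \<and> prob (f n) < d - c}"
  define v where "v = (SUP f\<in>S. prob (\<Union>n. f n))"
  have S0: "(\<lambda>_. {}) \<in> S" using assms by (auto simp: S_def)
  have bdd: "bdd_above ((\<lambda>f. prob (\<Union>n. f n)) ` S)" by (rule bdd_aboveI[of _ 1]) auto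
  have "\<exists>f\<in>S. v - 1 / Suc k < prob (\<Union>n. f n)" for k
  proof -
    have "v - 1 / Suc k < (SUP f\<in>S. prob (\<Union>n. f n))" by (simp add: v_def)
    moreover have "S \<noteq> {}" using S0 by blast
    ultimately show ?thesis using less_cSUP_iff[OF _ bdd] by blast
  qed
  then obtain F where F: "\<And>k. F k \<in> S" "\<And>k. v - 1 / Suc k < prob (\<Union>n. F k n)" by metis
  \<comment> \<open>Pairing of indices merges the near-optimal sequences \<open>F k\<close> into
    one, whose union has mass at least \<open>v\<close>.\<close>
  define f where "f n = F (fst (prod_decode n)) (snd (prod_decode n))" for n
  have f: "f n \<in> events" "prob (f n) < d - c" for n using F(1) by (auto simp: f_def S_def)
  define U where "U = (\<Union>n. f n)"
  have U: "U \<in> events" using f by (auto simp: U_def)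
  have "v \<le> prob U"
  proof (rule field_le_epsilon)
    fix e :: real assume "0 < e"
    then obtain k where k: "1 / Suc k < e" using nat_approx_posE by blast
    have "F k n \<subseteq> U" for n
    proof -
      have "f (prod_encode (k, n)) = F k n" by (simp add: f_def)
      then show ?thesis unfolding U_def by blast
    qed
    then have "prob (\<Union>n. F k n) \<le> prob U" using U by (intro finite_measure_mono) auto
    then show "v \<le> prob U + e" using F(2)[of k] k by linarith
  qed
  have "prob U = 1"
  proof (rule ccontr)
    assume "prob U \<noteq> 1"
    then have "0 < prob (space M - U)" using prob_compl[OF U] prob_le_1[of U] by linarith
    then obtain C where C: "C\<in>events" "C \<subseteq> space M - U" "0 < prob C" "prob C < d - c"
      using small U by blast
    \<comment> \<open>Prepending a small event of the complement to \<open>f\<close> gives a member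
      of \<open>S\<close> whose union has mass beyond \<open>v\<close>.\<close>
    define g where "g n = (case n of 0 \<Rightarrow> C | Suc m \<Rightarrow> f m)" for n
    have "g \<in> S" using C f by (auto simp: S_def g_def split: nat.split)
    then have "prob (\<Union>n. g n) \<le> v" unfolding v_def by (rule cSUP_upper[OF _ bdd])
    moreover have "(\<Union>n. g n) = C \<union> U"
    proof -
      have "g 0 = C" "g \<circ> Suc = f" by (simp_all add: g_def fun_eq_iff)
      moreover have "range g = insert (g 0) (range (g \<circ> Suc))"
        by (subst UNIV_nat_eq) (simp add: image_image)
      ultimately show ?thesis by (simp add: U_def)
    qed
    moreover have "prob (C \<union> U) = prob C + prob U"
      using C U by (intro finite_measure_Union) auto
    ultimately show False using C \<open>v \<le> prob U\<close> by simp
  qed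
  define A where "A n = (\<Union>i<n. f i)" for n
  have A: "A n \<in> events" for n using f by (auto simp: A_def)
  have "(\<lambda>n. prob (A n)) \<longlonglongrightarrow> prob (\<Union>n. A n)"
  proof (intro finite_Lim_measure_incseq)
    show "range A \<subseteq> events" using A by auto
    show "incseq A" unfolding A_def by (intro monoI UN_mono) auto
  qed
  moreover have "(\<Union>n. A n) = U"
  proof (rule set_eqI)
    fix x show "x \<in> (\<Union>n. A n) \<longleftrightarrow> x \<in> U"
      unfolding A_def U_def using lessI by fastforce
  qed
  ultimately have "eventually (\<lambda>n. c < prob (A n)) sequentially"
    using \<open>prob U = 1\<close> assms by (auto intro: order_tendstoD)
  then have ex: "\<exists>n. c < prob (A n)" by (auto simp: eventually_sequentially)
  \<comment> \<open>The partial union before the first one exceeding \<open>c\<close> has mass at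
    most \<open>c\<close>, and one more event adds less than \<open>d - c\<close>.\<close>
  define n where "n = (LEAST n. c < prob (A n))"
  have n: "c < prob (A n)" unfolding n_def using ex by (rule LeastI_ex)
  have "n \<noteq> 0"
  proof
    assume "n = 0"
    then show False using n assms(2) by (simp add: A_def)
  qed
  then obtain m where m: "n = Suc m" by (cases n) auto
  have "m < n" using m by simp
  then have "prob (A m) \<le> c" unfolding n_def using not_less_Least linorder_not_le by blast
  moreover have "A n = A m \<union> f m" unfolding A_def m by (simp add: lessThan_Suc Un_commute)
  moreover have "prob (A m \<union> f m) \<le> prob (A m) + prob (f m)"
    using A f by (intro measure_Un_le) auto
  ultimately have "prob (A n) < d" using f(2)[of m] by simp
  then show ?thesis using that A n by blast
qed

section \<open>A tangent inequality and integrals against mixtures\<close>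

text \<open>The convex function \<open>z powr r\<close> lies above its tangent at \<open>t\<close>.
  This is Young's inequality for \<open>z\<close> and \<open>t powr (r - 1)\<close> with exponents
  \<open>r\<close> and \<open>r / (r - 1)\<close>.\<close>

lemma powr_tangent:
  fixes z t r :: real
  assumes "0 \<le> z" "0 \<le> t" "1 < r"
  shows "r * t powr (r - 1) * z \<le> z powr r + (r - 1) * t powr r"
proof -
  have "z * t powr (r - 1) \<le> z powr r / r + (t powr (r - 1)) powr (r / (r - 1)) / (r / (r - 1))"
    using assms by (intro Youngs_inequality) (auto simp: field_simps)
  also have "(t powr (r - 1)) powr (r / (r - 1)) = t powr r" using assms by (simp add: powr_powr)
  finally show ?thesis using assms by (simp add: field_simps)
qed

lemma sets_mixture [simp, measurable_cong]: "sets (mixture l F G) = sets borel"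
  by (simp add: mixture_def sets.sets_measure_of_eq[of borel, simplified])

lemma space_mixture [simp]: "space (mixture l F G) = UNIV"
  by (simp add: mixture_def)

lemma nn_integral_mixture:
  assumes F: "sets F = sets borel" and G: "sets G = sets borel" and "h \<in> borel_measurable borel"
  shows "(\<integral>\<^sup>+x. h x \<partial>mixture l F G) =
    ennreal l * (\<integral>\<^sup>+x. h x \<partial>F) + ennreal (1 - l) * (\<integral>\<^sup>+x. h x \<partial>G)"
proof -
  have m: "w \<in> borel_measurable (mixture l F G)" "w \<in> borel_measurable F" "w \<in> borel_measurable G"
    if "w \<in> borel_measurable borel" for w :: "real \<Rightarrow> ennreal"
    using that by (simp_all cong: measurable_cong_sets add: F G)
  show ?thesis
    using assms(3)
  proof (induction h rule: borel_measurable_induct)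
    case (cong f g)
    then show ?case by (simp cong: nn_integral_cong)
  next
    case (set A)
    then show ?case by (simp add: emeasure_mixture F G)
  next
    case (mult u c)
    then show ?case by (simp add: nn_integral_cmult m distrib_left mult.left_commute)
  next
    case (add u v)
    then show ?case by (simp add: nn_integral_add m distrib_left ac_simps)
  next
    case (seq U)
    have *: "(\<integral>\<^sup>+x. (SUP i. U i) x \<partial>N) = (SUP i. \<integral>\<^sup>+x. U i x \<partial>N)" if "sets N = sets borel" for N
      unfolding SUP_apply
      by (rule nn_integral_monotone_convergence_SUP[OF \<open>incseq U\<close>])
        (use seq.hyps(1) that in \<open>simp cong: measurable_cong_sets\<close>)
    have inc: "incseq (\<lambda>i. c * (\<integral>\<^sup>+x. U i x \<partial>N))" for c :: ennreal and N
    proof (rule monoI)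
      fix i j :: nat assume "i \<le> j"
      then have "U i x \<le> U j x" for x using \<open>incseq U\<close> by (simp add: incseq_def le_fun_def)
      then show "c * (\<integral>\<^sup>+x. U i x \<partial>N) \<le> c * (\<integral>\<^sup>+x. U j x \<partial>N)"
        by (intro mult_left_mono nn_integral_mono) auto
    qed
    have "(SUP i. \<integral>\<^sup>+x. U i x \<partial>mixture l F G)
        = (SUP i. ennreal l * (\<integral>\<^sup>+x. U i x \<partial>F) + ennreal (1 - l) * (\<integral>\<^sup>+x. U i x \<partial>G))"
      using seq.IH by simp
    also have "\<dots> = (SUP i. ennreal l * (\<integral>\<^sup>+x. U i x \<partial>F)) + (SUP i. ennreal (1 - l) * (\<integral>\<^sup>+x. U i x \<partial>G))"
      by (rule ennreal_SUP_add[OF inc inc])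
    finally show ?case
      by (simp add: * F G SUP_mult_left_ennreal del: Sup_apply SUP_apply)
  qed
qed

lemma integral_mixture:
  fixes h :: "real \<Rightarrow> real"
  assumes F: "sets F = sets borel" and G: "sets G = sets borel" and l: "l \<in> {0..1}"
    and hF: "integrable F h" and hG: "integrable G h"
  shows "integrable (mixture l F G) h"
    and "integral\<^sup>L (mixture l F G) h = l * integral\<^sup>L F h + (1 - l) * integral\<^sup>L G h"
proof -
  have h[measurable]: "h \<in> borel_measurable borel"
    using borel_measurable_integrable[OF hF] by (simp cong: measurable_cong_sets add: F)
  show I: "integrable (mixture l F G) h"
    using hF hG unfolding integrable_iff_bounded
    by (simp add: nn_integral_mixture F G ennreal_mult_less_top cong: measurable_cong_sets)
  have fin: "(\<integral>\<^sup>+x. ennreal (g x) \<partial>N) < top" if "integrable N g" for g :: "real \<Rightarrow> real" and N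
    using that by (metis infinity_ennreal_def less_top real_integrable_def)
  \<comment> \<open>\<open>ennreal\<close> sends negative values to 0, so the instances
    \<open>h\<close> and \<open>\<lambda>x. - h x\<close> are the integrals of the positive and the
    negative part.\<close>
  have enn: "enn2real (\<integral>\<^sup>+x. ennreal (g x) \<partial>mixture l F G)
      = l * enn2real (\<integral>\<^sup>+x. ennreal (g x) \<partial>F) + (1 - l) * enn2real (\<integral>\<^sup>+x. ennreal (g x) \<partial>G)"
    if [measurable]: "g \<in> borel_measurable borel" "integrable F g" "integrable G g" for g
    using l fin[OF that(2)] fin[OF that(3)]
    by (simp add: nn_integral_mixture F G enn2real_plus ennreal_mult_less_top enn2real_mult)
  show "integral\<^sup>L (mixture l F G) h = l * integral\<^sup>L F h + (1 - l) * integral\<^sup>L G h"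
    using enn[of h] enn[of "\<lambda>x. - h x"] hF hG
    by (simp add: real_lebesgue_integral_def I hF hG algebra_simps)
qed

section \<open>Densities in place of absolutely continuous measures\<close>

text \<open>The densities of entropy at most log T, T = 1 / (1 - \<alpha>), with the logarithm
  removed: Z \<le> T almost everywhere, or E[Z^q] \<le> T^(q - 1). The set has this meaning for 0
  \<le> \<alpha> < 1.\<close>

definition evar_densities :: "ereal \<Rightarrow> 'a measure \<Rightarrow> real \<Rightarrow> ('a \<Rightarrow> real) set" where
  "evar_densities q M \<alpha> = {Z \<in> borel_measurable M. (\<forall>\<omega>. 0 \<le> Z \<omega>) \<and> (\<integral>\<^sup>+\<omega>. ennreal (Z \<omega>) \<partial>M) = 1 \<and>
     (if q = \<infinity> then AE \<omega> in M. Z \<omega> \<le> 1 / (1 - \<alpha>)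
      else (\<integral>\<^sup>+\<omega>. ennreal (Z \<omega> powr real_of_ereal q) \<partial>M)
        \<le> ennreal ((1 / (1 - \<alpha>)) powr (real_of_ereal q - 1)))}"

lemma conjugate_exponent_cases:
  assumes "1 \<le> p" "1 < q" "1 / ereal p + 1 / q = 1"
  obtains "p = 1" "q = \<infinity>" | r where "q = ereal r" "1 < r" "1 < p" "1 / p + 1 / r = 1"
proof (cases q)
  case (real r)
  then have r: "1 < r" "1 / p + 1 / r = 1" using assms by (simp_all add: one_ereal_def)
  then have "p \<noteq> 1" by auto
  then show ?thesis using that(2)[of r] r real assms(1) by simp
next
  case PInf
  then show ?thesis using that(1) assms by (simp add: one_ereal_def)
qed (use assms in auto)

text \<open>At \<open>E = 0\<close> the default value \<open>ln 0 = 0\<close> does no harm, since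
  \<open>1 \<le> K\<close> gives \<open>0 \<le> ln K\<close>. At \<open>E = \<infinity>\<close> the
  conversion \<open>enn2real\<close> would also give 0, hence the separate conjunct.\<close>

lemma ln_enn2real_le_iff:
  assumes "1 \<le> K"
  shows "(E \<noteq> \<infinity> \<and> ln (enn2real E) \<le> ln K) \<longleftrightarrow> E \<le> ennreal K"
proof (cases E)
  case (real x)
  then show ?thesis using assms by (cases "x = 0") auto
qed (use assms in \<open>auto simp: top_unique\<close>)

lemma nn_integral_le_ennrealD:
  fixes f :: "'a \<Rightarrow> real"
  assumes [measurable]: "f \<in> borel_measurable M" and f: "\<And>x. 0 \<le> f x"
    and le: "(\<integral>\<^sup>+x. ennreal (f x) \<partial>M) \<le> ennreal C" and C: "0 \<le> C"
  shows "integrable M f" and "integral\<^sup>L M f \<le> C"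
proof -
  have "(\<integral>\<^sup>+x. ennreal (f x) \<partial>M) < \<infinity>" by (rule le_less_trans[OF le]) simp
  then show I: "integrable M f" using f by (intro integrableI_nonneg) auto
  show "integral\<^sup>L M f \<le> C" using le C I f by (simp add: nn_integral_eq_integral)
qed

context prob_space
begin

lemma esssup_abs_nonneg:
  assumes [measurable]: "Z \<in> borel_measurable M"
  shows "0 \<le> esssup M (\<lambda>\<omega>. ereal \<bar>Z \<omega>\<bar>)"
proof -
  have "esssup M (\<lambda>\<omega>. 0 :: ereal) \<le> esssup M (\<lambda>\<omega>. ereal \<bar>Z \<omega>\<bar>)" by (rule esssup_mono) auto
  then show ?thesis by (simp add: esssup_const emeasure_space_1)
qed

text \<open>The Radon-Nikodym derivative in the entropy agrees with \<open>Z\<close> almost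
  everywhere, and both sides are insensitive to null sets. What remains is monotonicity of the
  logarithm.\<close>

lemma renyi_entropy_density_le_iff:
  assumes Z[measurable]: "Z \<in> borel_measurable M" and Z0: "\<And>\<omega>. 0 \<le> Z \<omega>"
    and \<alpha>: "0 \<le> \<alpha>" "\<alpha> < 1" and q: "1 < q"
  shows "renyi_entropy q M (density M (\<lambda>\<omega>. ennreal (Z \<omega>))) \<le> ereal (ln (1 / (1 - \<alpha>))) \<longleftrightarrow>
     (if q = \<infinity> then AE \<omega> in M. Z \<omega> \<le> 1 / (1 - \<alpha>)
      else (\<integral>\<^sup>+\<omega>. ennreal (Z \<omega> powr real_of_ereal q) \<partial>M)
        \<le> ennreal ((1 / (1 - \<alpha>)) powr (real_of_ereal q - 1)))"
proof -
  let ?Q = "density M (\<lambda>\<omega>. ennreal (Z \<omega>))"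
  define T where "T = 1 / (1 - \<alpha>)"
  have T: "1 \<le> T" using \<alpha> by (simp add: T_def)
  define W where "W \<omega> = enn2real (RN_deriv M ?Q \<omega>)" for \<omega>
  have W[measurable]: "W \<in> borel_measurable M" unfolding W_def by measurable
  have ac: "absolutely_continuous M ?Q" by (rule absolutely_continuousI_density) measurable
  have "AE \<omega> in M. ennreal (Z \<omega>) = RN_deriv M ?Q \<omega>" by (rule RN_deriv_unique) auto
  then have WZ: "AE \<omega> in M. W \<omega> = Z \<omega>"
    unfolding W_def by eventually_elim (metis Z0 enn2real_ennreal)
  show ?thesis
  proof (cases "q = \<infinity>")
    case True
    define N where "N = esssup M (\<lambda>\<omega>. ereal \<bar>W \<omega>\<bar>)"
    have N: "N = esssup M (\<lambda>\<omega>. ereal \<bar>Z \<omega>\<bar>)"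
      unfolding N_def by (rule esssup_AE_cong) (use WZ in auto)
    have N0: "0 \<le> N" unfolding N by (rule esssup_abs_nonneg) measurable
    have "renyi_entropy q M ?Q = (if N = \<infinity> then \<infinity> else ereal (ln (real_of_ereal N)))"
      unfolding renyi_entropy_def Let_def N_def W_def using ac True by simp
    then have "renyi_entropy q M ?Q \<le> ereal (ln T) \<longleftrightarrow> N \<le> ereal T"
      using N0 T by (cases N; cases "N = 0") auto
    also have "\<dots> \<longleftrightarrow> (AE \<omega> in M. Z \<omega> \<le> T)"
    proof
      assume "N \<le> ereal T"
      have "AE \<omega> in M. ereal \<bar>Z \<omega>\<bar> \<le> N" unfolding N by (rule esssup_AE)
      then have "AE \<omega> in M. ereal \<bar>Z \<omega>\<bar> \<le> ereal T"
        by eventually_elim (rule order_trans[OF _ \<open>N \<le> ereal T\<close>])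
      then show "AE \<omega> in M. Z \<omega> \<le> T" by eventually_elim simp
    next
      assume "AE \<omega> in M. Z \<omega> \<le> T"
      then have "AE \<omega> in M. ereal \<bar>Z \<omega>\<bar> \<le> ereal T" by eventually_elim (simp add: Z0)
      then show "N \<le> ereal T" unfolding N by (intro esssup_I) auto
    qed
    finally show ?thesis using True by (simp add: T_def)
  next
    case False
    then obtain r where r: "q = ereal r" "1 < r" using q by (cases q) (auto simp: one_ereal_def)
    define E where "E = (\<integral>\<^sup>+\<omega>. ennreal (W \<omega> powr r) \<partial>M)"
    have E: "E = (\<integral>\<^sup>+\<omega>. ennreal (Z \<omega> powr r) \<partial>M)"
      unfolding E_def using WZ by (intro nn_integral_cong_AE) (auto elim!: eventually_mono)
    have "renyi_entropy q M ?Q = (if E = \<infinity> then \<infinity> else ereal (1 / (r - 1) * ln (enn2real E)))"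
      unfolding renyi_entropy_def Let_def E_def W_def using ac r by simp
    moreover have "1 / (r - 1) * ln (enn2real E) \<le> ln T \<longleftrightarrow> ln (enn2real E) \<le> ln (T powr (r - 1))"
      using r T by (simp add: field_simps ln_powr)
    ultimately have "renyi_entropy q M ?Q \<le> ereal (ln T) \<longleftrightarrow> E \<noteq> \<infinity> \<and> ln (enn2real E) \<le> ln (T powr (r - 1))"
      by auto
    also have "\<dots> \<longleftrightarrow> E \<le> ennreal (T powr (r - 1))"
      using T r by (intro ln_enn2real_le_iff) (simp add: ge_one_powr_ge_zero)
    finally show ?thesis using r E by (simp add: T_def)
  qed
qed

text \<open>Finite entropy forces absolute continuity, so the admissible measures are exactly those
  with a density in \<open>evar_densities\<close>. Later suprema then run over functions under the
  one measure \<open>M\<close>.\<close>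

lemma EVaR_eq_SUP_densities:
  assumes X[measurable]: "X \<in> borel_measurable M" and \<alpha>: "0 \<le> \<alpha>" "\<alpha> < 1" and q: "1 < q"
  shows "EVaR q M \<alpha> X = (SUP Z\<in>evar_densities q M \<alpha>. ereal (\<integral>\<omega>. Z \<omega> * X \<omega> \<partial>M))"
proof -
  let ?D = "\<lambda>Z. density M (\<lambda>\<omega>. ennreal (Z \<omega>))"
  let ?S = "{Q. prob_space Q \<and> sets Q = sets M \<and> renyi_entropy q M Q \<le> ereal (ln (1 / (1 - \<alpha>)))}"
  have "?S = ?D ` evar_densities q M \<alpha>"
  proof (intro set_eqI iffI)
    fix Q assume "Q \<in> ?S"
    then have Q: "prob_space Q" "sets Q = sets M" "renyi_entropy q M Q \<le> ereal (ln (1 / (1 - \<alpha>)))" by auto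
    interpret Q: prob_space Q by fact
    have ac: "absolutely_continuous M Q"
      using Q(3) by (auto simp: renyi_entropy_def split: if_splits)
    define Z where "Z \<omega> = enn2real (RN_deriv M Q \<omega>)" for \<omega>
    have [measurable]: "Z \<in> borel_measurable M" unfolding Z_def by measurable
    have "AE \<omega> in M. ennreal (Z \<omega>) = RN_deriv M Q \<omega>"
      using RN_deriv_finite[OF Q.sigma_finite_measure_axioms ac Q(2)]
      by eventually_elim (simp add: Z_def less_top)
    then have "?D Z = density M (RN_deriv M Q)" by (intro density_cong) auto
    also have "\<dots> = Q" by (rule density_RN_deriv[OF ac Q(2)])
    finally have QZ: "Q = ?D Z" by simp
    have "(\<integral>\<^sup>+\<omega>. ennreal (Z \<omega>) \<partial>M) = emeasure Q (space M)"
      by (simp add: QZ emeasure_density nn_set_integral_space)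
    also have "space M = space Q" using sets_eq_imp_space_eq[OF Q(2)] by simp
    finally have "(\<integral>\<^sup>+\<omega>. ennreal (Z \<omega>) \<partial>M) = 1" by (simp add: Q.emeasure_space_1)
    then have "Z \<in> evar_densities q M \<alpha>"
      using renyi_entropy_density_le_iff[of Z \<alpha> q] Q(3) \<alpha> q unfolding QZ
      by (simp add: evar_densities_def Z_def[of "_"])
    then show "Q \<in> ?D ` evar_densities q M \<alpha>" using QZ by blast
  next
    fix Q assume "Q \<in> ?D ` evar_densities q M \<alpha>"
    then obtain Z where Z: "Z \<in> evar_densities q M \<alpha>" and Q: "Q = ?D Z" by blast
    have [measurable]: "Z \<in> borel_measurable M" using Z by (simp add: evar_densities_def)
    have "emeasure (?D Z) (space M) = 1"
      using Z by (simp add: emeasure_density nn_set_integral_space evar_densities_def)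
    then have "prob_space (?D Z)" by (intro prob_spaceI) simp
    then show "Q \<in> ?S"
      using renyi_entropy_density_le_iff[of Z \<alpha> q] Z \<alpha> q unfolding Q by (simp add: evar_densities_def)
  qed
  moreover have "integral\<^sup>L (?D Z) X = (\<integral>\<omega>. Z \<omega> * X \<omega> \<partial>M)" if "Z \<in> evar_densities q M \<alpha>" for Z
    using that by (subst integral_density) (auto simp: evar_densities_def)
  ultimately show ?thesis using \<alpha> by (simp add: EVaR_def image_image)
qed

text \<open>\<open>M\<close> itself has entropy 0 and is admissible at every level below 1; this
  keeps the suprema from ranging over an empty set.\<close>

lemma one_in_evar_densities:
  assumes \<alpha>: "0 \<le> \<alpha>" "\<alpha> < 1" and q: "1 < q"
  shows "(\<lambda>_. 1) \<in> evar_densities q M \<alpha>"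
proof -
  have "1 \<le> real_of_ereal q" if "q \<noteq> \<infinity>" using q that by (cases q) (auto simp: one_ereal_def)
  then show ?thesis
    using \<alpha> by (simp add: evar_densities_def emeasure_space_1 ge_one_powr_ge_zero)
qed

text \<open>This is the density of the conditional measure given \<open>A\<close>. Its r-th moment
  is (1 / P(A))^(r - 1), so its entropy is log(1 / P(A)) for every order.\<close>

lemma indicator_in_evar_densities:
  assumes A[measurable]: "A \<in> events" and \<alpha>: "0 \<le> \<alpha>" "\<alpha> < 1" and q: "1 < q" and PA: "1 - \<alpha> \<le> prob A"
  shows "(\<lambda>\<omega>. indicator A \<omega> / prob A) \<in> evar_densities q M \<alpha>"
proof -
  have pos: "0 < prob A" using PA \<alpha> by simp
  have T: "1 / prob A \<le> 1 / (1 - \<alpha>)" using PA \<alpha> by (simp add: frac_le)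
  have int: "(\<integral>\<^sup>+\<omega>. ennreal (c * indicator A \<omega>) \<partial>M) = ennreal (c * prob A)" if "0 \<le> c" for c
    using that by (simp add: ennreal_mult ennreal_indicator nn_integral_cmult emeasure_eq_measure)
  have i1: "(\<integral>\<^sup>+\<omega>. ennreal (indicator A \<omega> / prob A) \<partial>M) = 1"
    using int[of "1 / prob A"] pos by simp
  have "(\<integral>\<^sup>+\<omega>. ennreal ((indicator A \<omega> / prob A) powr r) \<partial>M) \<le> ennreal ((1 / (1 - \<alpha>)) powr (r - 1))"
    if "1 < r" for r
  proof -
    have "(indicator A \<omega> / prob A) powr r = (1 / prob A) powr r * indicator A \<omega>" for \<omega>
      using that by (cases "\<omega> \<in> A") auto
    then have "(\<integral>\<^sup>+\<omega>. ennreal ((indicator A \<omega> / prob A) powr r) \<partial>M) = ennreal ((1 / prob A) powr r * prob A)"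
      by (simp add: int)
    also have "(1 / prob A) powr r * prob A = (1 / prob A) powr (r - 1)"
      using pos by (simp add: powr_diff)
    also have "\<dots> \<le> (1 / (1 - \<alpha>)) powr (r - 1)" using T pos that by (intro powr_mono2) auto
    finally show ?thesis using ennreal_leI by blast
  qed
  moreover have "1 < real_of_ereal q" if "q \<noteq> \<infinity>" using q that by (cases q) (auto simp: one_ereal_def)
  moreover have "indicator A \<omega> / prob A \<le> 1 / (1 - \<alpha>)" for \<omega>
    using T \<alpha> by (cases "\<omega> \<in> A") auto
  ultimately show ?thesis unfolding evar_densities_def using i1 by auto
qed

text \<open>For finite \<open>q\<close>, Young's inequality dominates the product pointwise by
  integrable powers; for \<open>q = \<infinity>\<close> the density is essentially bounded.\<close>

lemma integrable_mult_evar_density: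
  assumes p: "1 \<le> p" and q: "1 < q" "1 / ereal p + 1 / q = 1"
    and Z: "Z \<in> evar_densities q M \<alpha>" and X: "X \<in> Lp p M"
  shows "integrable M (\<lambda>\<omega>. Z \<omega> * X \<omega>)"
proof -
  have [measurable]: "Z \<in> borel_measurable M" "X \<in> borel_measurable M" and Z0: "\<And>\<omega>. 0 \<le> Z \<omega>"
    using Z X by (auto simp: evar_densities_def Lp_def)
  have Xp: "integrable M (\<lambda>\<omega>. \<bar>X \<omega>\<bar> powr p)" using X by (simp add: Lp_def)
  from p q show ?thesis
  proof (cases rule: conjugate_exponent_cases)
    case 1
    then have "AE \<omega> in M. Z \<omega> \<le> 1 / (1 - \<alpha>)" using Z by (simp add: evar_densities_def)
    then have "AE \<omega> in M. norm (Z \<omega> * X \<omega>) \<le> norm (1 / (1 - \<alpha>) * (\<bar>X \<omega>\<bar> powr p))"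
    proof eventually_elim
      case (elim \<omega>)
      \<comment> \<open>\<open>\<alpha>\<close> is unrestricted here; the sign is read off from
        \<open>0 \<le> Z \<omega>\<close> and
        \<open>Z \<omega> \<le> 1 / (1 - \<alpha>)\<close>.\<close>
      then have "0 \<le> 1 / (1 - \<alpha>)" using Z0[of \<omega>] by (rule order_trans[rotated])
      moreover have "Z \<omega> * \<bar>X \<omega>\<bar> \<le> 1 / (1 - \<alpha>) * \<bar>X \<omega>\<bar>" using elim by (rule mult_right_mono) simp
      ultimately show ?case using Z0[of \<omega>] 1 by (simp add: abs_mult)
    qed
    then show ?thesis by (rule Bochner_Integration.integrable_bound[rotated 2]) (use Xp in auto)
  next
    case (2 r)
    then have *: "(\<integral>\<^sup>+\<omega>. ennreal (Z \<omega> powr r) \<partial>M) \<le> ennreal ((1 / (1 - \<alpha>)) powr (r - 1))"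
      using Z by (simp add: evar_densities_def)
    have "integrable M (\<lambda>\<omega>. Z \<omega> powr r)"
      by (rule nn_integral_le_ennrealD(1)[OF _ _ *]) simp_all
    then have I: "integrable M (\<lambda>\<omega>. Z \<omega> powr r / r + \<bar>X \<omega>\<bar> powr p / p)"
      using Xp by simp
    have "norm (Z \<omega> * X \<omega>) \<le> norm (Z \<omega> powr r / r + \<bar>X \<omega>\<bar> powr p / p)" for \<omega>
      using Youngs_inequality[of r p "Z \<omega>" "\<bar>X \<omega>\<bar>"] 2 Z0[of \<omega>] by (simp add: abs_mult)
    then show ?thesis
      by (intro Bochner_Integration.integrable_bound[OF I] AE_I2) measurable
  qed
qed

lemma integrable_evar_density:
  assumes "Z \<in> evar_densities q M \<alpha>"
  shows "integrable M Z" and "integral\<^sup>L M Z = 1"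
proof -
  have "has_bochner_integral M Z 1"
    using assms by (intro has_bochner_integral_nn_integral) (auto simp: evar_densities_def)
  then show "integrable M Z" "integral\<^sup>L M Z = 1" by (auto simp: has_bochner_integral_iff)
qed

text \<open>Hoelder's inequality would give (T P(A))^(1/p) with T = 1 / (1 - \<alpha>); the bound
  here is the tangent line of u^(1/p) at u = 1, taken at u = T P(A). It is below 1 exactly when
  \<open>prob A < 1 - \<alpha>\<close>, as the converse directions need, and includes
  \<open>p = 1\<close>.\<close>

lemma integral_evar_density_indicator_le:
  assumes p: "1 \<le> p" and q: "1 < q" "1 / ereal p + 1 / q = 1"
    and Z: "Z \<in> evar_densities q M \<alpha>" and \<alpha>: "\<alpha> < 1" and A[measurable]: "A \<in> events"
  shows "(\<integral>\<omega>. Z \<omega> * indicator A \<omega> \<partial>M) \<le> 1 - (1 - prob A / (1 - \<alpha>)) / p"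
proof -
  have [measurable]: "Z \<in> borel_measurable M" and Z0: "\<And>\<omega>. 0 \<le> Z \<omega>"
    using Z by (auto simp: evar_densities_def)
  have int: "integrable M (\<lambda>\<omega>. Z \<omega> * indicator A \<omega>)"
    using integrable_evar_density(1)[OF Z] integrable_real_mult_indicator[OF A] by (simp add: mult.commute)
  have ind: "integrable M (indicator A :: 'a \<Rightarrow> real)"
    by (intro integrable_real_indicator A) (simp add: emeasure_eq_measure)
  define T where "T = 1 / (1 - \<alpha>)"
  have T: "0 < T" using \<alpha> by (simp add: T_def)
  from p q show ?thesis
  proof (cases rule: conjugate_exponent_cases)
    case 1
    then have "AE \<omega> in M. Z \<omega> \<le> T" using Z by (simp add: evar_densities_def T_def)
    then have "AE \<omega> in M. Z \<omega> * indicator A \<omega> \<le> T * indicator A \<omega>"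
      by eventually_elim (auto intro: mult_right_mono)
    then have "(\<integral>\<omega>. Z \<omega> * indicator A \<omega> \<partial>M) \<le> (\<integral>\<omega>. T * indicator A \<omega> \<partial>M)"
      using ind by (intro integral_mono_AE int) auto
    then show ?thesis using 1 by (simp add: T_def)
  next
    case (2 r)
    then have *: "(\<integral>\<^sup>+\<omega>. ennreal (Z \<omega> powr r) \<partial>M) \<le> ennreal (T powr (r - 1))"
      using Z by (simp add: evar_densities_def T_def)
    have Zr: "integrable M (\<lambda>\<omega>. Z \<omega> powr r)" and Zr': "(\<integral>\<omega>. Z \<omega> powr r \<partial>M) \<le> T powr (r - 1)"
      by (rule nn_integral_le_ennrealD[OF _ _ *]; simp)+
    \<comment> \<open>On \<open>A\<close> this is \<open>powr_tangent\<close> at the constant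
      \<open>T\<close>, the value of the conditional density when
      \<open>prob A = 1 - \<alpha>\<close>; off \<open>A\<close> the left side is 0.\<close>
    have "r * T powr (r - 1) * (Z \<omega> * indicator A \<omega>) \<le> Z \<omega> powr r + (r - 1) * T powr r * indicator A \<omega>" for \<omega>
      using powr_tangent[of "Z \<omega>" T r] 2 Z0[of \<omega>] T by (cases "\<omega> \<in> A") auto
    then have "(\<integral>\<omega>. r * T powr (r - 1) * (Z \<omega> * indicator A \<omega>) \<partial>M)
        \<le> (\<integral>\<omega>. Z \<omega> powr r + (r - 1) * T powr r * indicator A \<omega> \<partial>M)"
      by (intro integral_mono) (use int Zr ind in auto)
    then have "r * T powr (r - 1) * (\<integral>\<omega>. Z \<omega> * indicator A \<omega> \<partial>M)
        \<le> (\<integral>\<omega>. Z \<omega> powr r \<partial>M) + (r - 1) * T powr r * prob A"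
      using Zr ind by simp
    also have "\<dots> \<le> T powr (r - 1) * (1 + (r - 1) * (T * prob A))"
      using Zr' T by (simp add: powr_diff algebra_simps)
    finally have "r * (\<integral>\<omega>. Z \<omega> * indicator A \<omega> \<partial>M) \<le> 1 + (r - 1) * (T * prob A)"
      using T by (simp add: mult.assoc mult.left_commute[of r])
    then have "(\<integral>\<omega>. Z \<omega> * indicator A \<omega> \<partial>M) \<le> 1 / r + (1 - 1 / r) * (T * prob A)"
      using 2 by (simp add: field_simps)
    also have "\<dots> = 1 - (1 - T * prob A) / p"
    proof -
      have r: "1 / r = 1 - 1 / p" using 2 by simp
      show ?thesis unfolding r using p by (simp add: field_simps)
    qed
    finally show ?thesis by (simp add: T_def)
  qed
qed


section \<open>Densities for mixtures\<close>

lemma integral_distr_mixture: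
  assumes [measurable]: "X \<in> borel_measurable M" "Y \<in> borel_measurable M" "W \<in> borel_measurable M"
      "h \<in> borel_measurable borel"
    and l: "l \<in> {0..1}"
    and W: "distr M borel W = mixture l (distr M borel X) (distr M borel Y)"
    and hX: "integrable M (\<lambda>\<omega>. h (X \<omega>))" and hY: "integrable M (\<lambda>\<omega>. h (Y \<omega>))"
  shows "(\<integral>\<omega>. h (W \<omega>) \<partial>M) = l * (\<integral>\<omega>. h (X \<omega>) \<partial>M) + (1 - l) * (\<integral>\<omega>. h (Y \<omega>) \<partial>M :: real)"
proof -
  have "(\<integral>\<omega>. h (W \<omega>) \<partial>M) = integral\<^sup>L (mixture l (distr M borel X) (distr M borel Y)) h"
    by (simp flip: W add: integral_distr)
  also have "\<dots> = l * integral\<^sup>L (distr M borel X) h + (1 - l) * integral\<^sup>L (distr M borel Y) h"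
    using l hX hY by (intro integral_mixture) (auto simp: integrable_distr_eq)
  finally show ?thesis by (simp add: integral_distr)
qed

text \<open>The density is \<open>d\<nu>/dH\<close> with \<open>H\<close> the law of \<open>W\<close> and \<open>\<nu>\<close> the mixture of the
  laws of \<open>X\<close> and \<open>Y\<close> under the measures with densities \<open>Z\<^sub>1\<close> and \<open>Z\<^sub>2\<close>.\<close>

lemma mixture_density:
  assumes [measurable]: "X \<in> borel_measurable M" "Y \<in> borel_measurable M" "W \<in> borel_measurable M"
    and l: "l \<in> {0..1}"
    and W: "distr M borel W = mixture l (distr M borel X) (distr M borel Y)"
    and Z1: "Z1 \<in> evar_densities q M \<alpha>" and Z2: "Z2 \<in> evar_densities q M \<alpha>"
  obtains g :: "real \<Rightarrow> real" where "g \<in> borel_measurable borel" "\<And>x. 0 \<le> g x"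
    "\<And>h. \<lbrakk>h \<in> borel_measurable borel; integrable M (\<lambda>\<omega>. Z1 \<omega> * h (X \<omega>)); integrable M (\<lambda>\<omega>. Z2 \<omega> * h (Y \<omega>))\<rbrakk> \<Longrightarrow>
        integrable M (\<lambda>\<omega>. g (W \<omega>) * h (W \<omega>)) \<and>
        (\<integral>\<omega>. g (W \<omega>) * h (W \<omega>) \<partial>M) = l * (\<integral>\<omega>. Z1 \<omega> * h (X \<omega>) \<partial>M) + (1 - l) * (\<integral>\<omega>. Z2 \<omega> * h (Y \<omega>) \<partial>M)"
proof -
  have [measurable]: "Z1 \<in> borel_measurable M" "Z2 \<in> borel_measurable M"
    and nn: "\<And>\<omega>. 0 \<le> Z1 \<omega>" "\<And>\<omega>. 0 \<le> Z2 \<omega>"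
    using Z1 Z2 by (auto simp: evar_densities_def)
  define law where "law Z V = distr (density M (\<lambda>\<omega>. ennreal (Z \<omega>))) borel V" for Z V :: "'a \<Rightarrow> real"
  define \<nu> where "\<nu> = mixture l (law Z1 X) (law Z2 Y)"
  have sets_law: "sets (law Z V) = sets borel" for Z V by (simp add: law_def)
  have emeasure_\<nu>: "emeasure \<nu> A = ennreal l * emeasure (law Z1 X) A + ennreal (1 - l) * emeasure (law Z2 Y) A"
    if "A \<in> sets borel" for A
    using that unfolding \<nu>_def by (intro emeasure_mixture sets_law)
  define H where "H = distr M borel W"
  interpret H: prob_space H unfolding H_def by (rule prob_space_distr) measurable
  have law_null: "emeasure (law Z V) A = 0"
    if [measurable]: "Z \<in> borel_measurable M" "V \<in> borel_measurable M" "A \<in> sets borel"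
      and "emeasure (distr M borel V) A = 0" for Z V A
  proof -
    have "V -` A \<inter> space M \<in> null_sets M" using that by (auto simp: emeasure_distr null_sets_def)
    moreover have "absolutely_continuous M (density M (\<lambda>\<omega>. ennreal (Z \<omega>)))"
      by (rule absolutely_continuousI_density) measurable
    ultimately have "V -` A \<inter> space M \<in> null_sets (density M (\<lambda>\<omega>. ennreal (Z \<omega>)))"
      by (auto simp: absolutely_continuous_def)
    then show ?thesis by (simp add: law_def emeasure_distr null_sets_def)
  qed
  \<comment> \<open>A null set of \<open>H\<close> is null for each component law of positive
    weight, and reweighting by a density keeps it null.\<close>
  have ac: "absolutely_continuous H \<nu>"
    unfolding absolutely_continuous_def
  proof
    fix A assume "A \<in> null_sets H"
    then have A: "A \<in> sets borel" "emeasure H A = 0" by (auto simp: H_def)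
    then have "ennreal l * emeasure (distr M borel X) A + ennreal (1 - l) * emeasure (distr M borel Y) A = 0"
      unfolding H_def W by (subst (asm) emeasure_mixture) auto
    then have "ennreal l * emeasure (law Z1 X) A = 0" "ennreal (1 - l) * emeasure (law Z2 Y) A = 0"
      using law_null[of Z1 X A] law_null[of Z2 Y A] A by auto
    then have "emeasure \<nu> A = 0" using A by (simp add: emeasure_\<nu>)
    then show "A \<in> null_sets \<nu>" using A by (auto simp: null_sets_def \<nu>_def)
  qed
  have law_UNIV: "emeasure (law Z V) UNIV = 1"
    if [measurable]: "V \<in> borel_measurable M" and "Z \<in> evar_densities q M \<alpha>" for Z V
    using that by (simp add: law_def emeasure_distr emeasure_density nn_set_integral_space evar_densities_def)
  have "prob_space \<nu>"
    using l Z1 Z2 by (intro prob_spaceI)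
      (simp add: emeasure_\<nu> \<nu>_def[THEN arg_cong, of space] law_UNIV ennreal_plus[symmetric] del: ennreal_plus)
  then interpret N: prob_space \<nu> .
  have sets_\<nu>: "sets \<nu> = sets H" by (simp add: \<nu>_def H_def)
  define g where "g x = enn2real (RN_deriv H \<nu> x)" for x
  have g[measurable]: "g \<in> borel_measurable borel"
    using borel_measurable_RN_deriv[of H \<nu>] unfolding g_def H_def
    by (simp cong: measurable_cong_sets)
  have "AE x in H. ennreal (g x) = RN_deriv H \<nu> x"
    using H.RN_deriv_finite[OF N.sigma_finite_measure_axioms ac sets_\<nu>]
    by eventually_elim (simp add: g_def less_top)
  then have "density H (\<lambda>x. ennreal (g x)) = density H (RN_deriv H \<nu>)"
    using g by (intro density_cong) (auto simp: H_def)
  also have "\<dots> = \<nu>" by (rule H.density_RN_deriv[OF ac sets_\<nu>])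
  finally have dens: "density H (\<lambda>x. ennreal (g x)) = \<nu>" .
  have g0: "0 \<le> g x" for x by (simp add: g_def)
  show ?thesis
  proof (rule that[OF g g0])
    fix h :: "real \<Rightarrow> real"
    assume [measurable]: "h \<in> borel_measurable borel"
      and I: "integrable M (\<lambda>\<omega>. Z1 \<omega> * h (X \<omega>))" "integrable M (\<lambda>\<omega>. Z2 \<omega> * h (Y \<omega>))"
    have law: "integrable (law Z V) h \<longleftrightarrow> integrable M (\<lambda>\<omega>. Z \<omega> * h (V \<omega>))"
        "integral\<^sup>L (law Z V) h = (\<integral>\<omega>. Z \<omega> * h (V \<omega>) \<partial>M)"
      if [measurable]: "Z \<in> borel_measurable M" "V \<in> borel_measurable M" and "\<And>\<omega>. 0 \<le> Z \<omega>" for Z V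
      using that(3) by (simp_all add: law_def integrable_distr_eq integral_distr integrable_density integral_density)
    have L: "integrable (law Z1 X) h" "integrable (law Z2 Y) h" using law nn I by simp_all
    note mix = integral_mixture[OF sets_law sets_law l L, folded \<nu>_def]
    have [measurable]: "h \<in> borel_measurable H" "g \<in> borel_measurable H" by (simp_all add: H_def)
    have "integrable H (\<lambda>x. g x * h x)" "integral\<^sup>L \<nu> h = (\<integral>x. g x * h x \<partial>H)"
      using mix(1) g0 unfolding dens[symmetric] by (simp_all add: integrable_density integral_density)
    then have "integrable M (\<lambda>\<omega>. g (W \<omega>) * h (W \<omega>))" "integral\<^sup>L \<nu> h = (\<integral>\<omega>. g (W \<omega>) * h (W \<omega>) \<partial>M)"
      unfolding H_def by (simp_all add: integrable_distr_eq integral_distr)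
    then show "integrable M (\<lambda>\<omega>. g (W \<omega>) * h (W \<omega>)) \<and>
        (\<integral>\<omega>. g (W \<omega>) * h (W \<omega>) \<partial>M) = l * (\<integral>\<omega>. Z1 \<omega> * h (X \<omega>) \<partial>M) + (1 - l) * (\<integral>\<omega>. Z2 \<omega> * h (Y \<omega>) \<partial>M)"
      using mix(2) law nn by simp
  qed
qed

text \<open>The density is \<open>g (W \<omega>)\<close> with \<open>g\<close> from
  \<open>mixture_density\<close>, whose integral identity reduces every claim to a test function
  \<open>h\<close>: the constant 1 for the total mass, an indicator or a truncated power for the
  entropy bound, the identity for the expectations.\<close>

lemma evar_densities_mixture:
  assumes X[measurable]: "X \<in> borel_measurable M" and Y[measurable]: "Y \<in> borel_measurable M"
    and W[measurable]: "W \<in> borel_measurable M"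
    and l: "l \<in> {0..1}" and q: "1 < q"
    and mix: "distr M borel W = mixture l (distr M borel X) (distr M borel Y)"
    and Z1: "Z1 \<in> evar_densities q M \<alpha>" and Z2: "Z2 \<in> evar_densities q M \<alpha>"
    and I1: "integrable M (\<lambda>\<omega>. Z1 \<omega> * X \<omega>)" and I2: "integrable M (\<lambda>\<omega>. Z2 \<omega> * Y \<omega>)"
  obtains Z where "Z \<in> evar_densities q M \<alpha>"
    "(\<integral>\<omega>. Z \<omega> * W \<omega> \<partial>M) = l * (\<integral>\<omega>. Z1 \<omega> * X \<omega> \<partial>M) + (1 - l) * (\<integral>\<omega>. Z2 \<omega> * Y \<omega> \<partial>M)"
proof -
  have [measurable]: "Z1 \<in> borel_measurable M" "Z2 \<in> borel_measurable M"
    and nn: "\<And>\<omega>. 0 \<le> Z1 \<omega>" "\<And>\<omega>. 0 \<le> Z2 \<omega>"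
    using Z1 Z2 by (auto simp: evar_densities_def)
  note iZ = integrable_evar_density[OF Z1] integrable_evar_density[OF Z2]
  obtain g :: "real \<Rightarrow> real" where g[measurable]: "g \<in> borel_measurable borel" and g0: "\<And>x. 0 \<le> g x"
    and K: "\<And>h. \<lbrakk>h \<in> borel_measurable borel; integrable M (\<lambda>\<omega>. Z1 \<omega> * h (X \<omega>)); integrable M (\<lambda>\<omega>. Z2 \<omega> * h (Y \<omega>))\<rbrakk> \<Longrightarrow>
        integrable M (\<lambda>\<omega>. g (W \<omega>) * h (W \<omega>)) \<and>
        (\<integral>\<omega>. g (W \<omega>) * h (W \<omega>) \<partial>M) = l * (\<integral>\<omega>. Z1 \<omega> * h (X \<omega>) \<partial>M) + (1 - l) * (\<integral>\<omega>. Z2 \<omega> * h (Y \<omega>) \<partial>M)"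
    using mixture_density[OF X Y W l mix Z1 Z2] by blast
  define Z where "Z \<omega> = g (W \<omega>)" for \<omega>
  have [measurable]: "Z \<in> borel_measurable M" unfolding Z_def by measurable
  have Z0: "0 \<le> Z \<omega>" for \<omega> by (simp add: Z_def g0)
  have ZI: "integrable M Z" and Z1': "integral\<^sup>L M Z = 1"
    using K[of "\<lambda>_. 1"] iZ unfolding Z_def[abs_def] by simp_all
  have nnZ: "(\<integral>\<^sup>+\<omega>. ennreal (Z \<omega>) \<partial>M) = 1"
    using ZI Z1' Z0 by (simp add: nn_integral_eq_integral)
  have bdd_int: "integrable M (\<lambda>\<omega>. h (V \<omega>))" "integrable M (\<lambda>\<omega>. U \<omega> * h (V \<omega>))"
    if [measurable]: "h \<in> borel_measurable borel" "V \<in> borel_measurable M" and h: "\<And>x. \<bar>h x\<bar> \<le> C"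
      and U: "integrable M U" for h U V :: "_ \<Rightarrow> real" and C :: real
  proof -
    show "integrable M (\<lambda>\<omega>. h (V \<omega>))" by (rule integrable_const_bound[of _ C]) (use h in auto)
    have [measurable]: "U \<in> borel_measurable M" using U by auto
    show "integrable M (\<lambda>\<omega>. U \<omega> * h (V \<omega>))"
      by (rule Bochner_Integration.integrable_bound[of M "\<lambda>\<omega>. C * U \<omega>"])
        (use U h order_trans[OF abs_ge_zero h] in \<open>auto simp: abs_mult mult.commute[of _ "\<bar>U _\<bar>"] intro!: mult_left_mono\<close>)
  qed
  note hmix = integral_distr_mixture[OF X Y W _ l mix]
  have bound: "if q = \<infinity> then AE \<omega> in M. Z \<omega> \<le> 1 / (1 - \<alpha>)
      else (\<integral>\<^sup>+\<omega>. ennreal (Z \<omega> powr real_of_ereal q) \<partial>M)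
        \<le> ennreal ((1 / (1 - \<alpha>)) powr (real_of_ereal q - 1))"
  proof (cases "q = \<infinity>")
    case True
    define T where "T = 1 / (1 - \<alpha>)"
    \<comment> \<open>\<open>h\<close> singles out the points where the bound fails. As a test
      function it gives E[(Z - T) h(W)] \<le> 0 although the integrand is nonnegative, so the
      integrand vanishes almost everywhere.\<close>
    define h :: "real \<Rightarrow> real" where "h = indicator {x. T < g x}"
    have [measurable]: "h \<in> borel_measurable borel" unfolding h_def by measurable
    have h: "\<bar>h x\<bar> \<le> 1" "0 \<le> h x" for x by (simp_all add: h_def indicator_def)
    note B = bdd_int[OF \<open>h \<in> borel_measurable borel\<close> _ h(1)]
    have le: "(\<integral>\<omega>. U \<omega> * h (V \<omega>) \<partial>M) \<le> T * (\<integral>\<omega>. h (V \<omega>) \<partial>M)"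
      if U: "U \<in> evar_densities q M \<alpha>" and [measurable]: "V \<in> borel_measurable M" for U V
    proof -
      have "AE \<omega> in M. U \<omega> \<le> T" using U True by (simp add: evar_densities_def T_def)
      then have "AE \<omega> in M. U \<omega> * h (V \<omega>) \<le> T * h (V \<omega>)"
        by eventually_elim (rule mult_right_mono[OF _ h(2)])
      then have "(\<integral>\<omega>. U \<omega> * h (V \<omega>) \<partial>M) \<le> (\<integral>\<omega>. T * h (V \<omega>) \<partial>M)"
        using B[of V U] integrable_evar_density[OF U] by (intro integral_mono_AE) auto
      then show ?thesis by simp
    qed
    have KI: "integrable M (\<lambda>\<omega>. Z \<omega> * h (W \<omega>))" and
      "(\<integral>\<omega>. Z \<omega> * h (W \<omega>) \<partial>M) = l * (\<integral>\<omega>. Z1 \<omega> * h (X \<omega>) \<partial>M) + (1 - l) * (\<integral>\<omega>. Z2 \<omega> * h (Y \<omega>) \<partial>M)"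
      using K[of h] B iZ by (auto simp: Z_def)
    note this(2)
    also have "\<dots> \<le> l * (T * (\<integral>\<omega>. h (X \<omega>) \<partial>M)) + (1 - l) * (T * (\<integral>\<omega>. h (Y \<omega>) \<partial>M))"
      using l by (intro add_mono mult_left_mono le Z1 Z2) auto
    also have "\<dots> = T * (\<integral>\<omega>. h (W \<omega>) \<partial>M)"
      by (subst hmix[of h]) (use B(1)[of X "\<lambda>_. 0"] B(1)[of Y "\<lambda>_. 0"] in \<open>auto simp: algebra_simps\<close>)
    finally have "(\<integral>\<omega>. Z \<omega> * h (W \<omega>) - T * h (W \<omega>) \<partial>M) \<le> 0"
      using KI B(1)[of W "\<lambda>_. 0"] by simp
    moreover have ge: "0 \<le> Z \<omega> * h (W \<omega>) - T * h (W \<omega>)" for \<omega>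
      by (auto simp: h_def Z_def indicator_def)
    ultimately have "(\<integral>\<omega>. Z \<omega> * h (W \<omega>) - T * h (W \<omega>) \<partial>M) = 0"
      by (intro antisym integral_nonneg) auto
    then have "AE \<omega> in M. Z \<omega> * h (W \<omega>) - T * h (W \<omega>) = 0"
      using KI B(1)[of W "\<lambda>_. 0"] ge by (subst (asm) integral_nonneg_eq_0_iff_AE) auto
    then have "AE \<omega> in M. Z \<omega> \<le> T"
      by eventually_elim (auto simp: h_def Z_def indicator_def split: if_splits)
    then show ?thesis using True by (simp add: T_def)
  next
    case False
    then obtain r where r: "q = ereal r" "1 < r" using q by (cases q) (auto simp: one_ereal_def)
    define C where "C = (1 / (1 - \<alpha>)) powr (r - 1)"
    have C: "integrable M (\<lambda>\<omega>. U \<omega> powr r)" "(\<integral>\<omega>. U \<omega> powr r \<partial>M) \<le> C"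
      if "U \<in> evar_densities q M \<alpha>" for U
    proof -
      have [measurable]: "U \<in> borel_measurable M" and *: "(\<integral>\<^sup>+\<omega>. ennreal (U \<omega> powr r) \<partial>M) \<le> ennreal C"
        using that r by (auto simp: evar_densities_def C_def)
      show "integrable M (\<lambda>\<omega>. U \<omega> powr r)" "(\<integral>\<omega>. U \<omega> powr r \<partial>M) \<le> C"
        by (rule nn_integral_le_ennrealD[OF _ _ *]; simp add: C_def)+
    qed
    \<comment> \<open>Cutting \<open>g\<close> off to 0 above \<open>n\<close>, rather than capping
      it at \<open>n\<close>, gives \<open>g x * t n x powr (r - 1) = t n x powr r\<close> exactly,
      and boundedness makes the moments finite.\<close>
    define t where "t n x = (if g x \<le> real n then g x else 0)" for n x
    have [measurable]: "t n \<in> borel_measurable borel" for n unfolding t_def by measurable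
    have t: "0 \<le> t n x" "t n x \<le> real n" for n x by (auto simp: t_def g0)
    have tp: "\<bar>t n x powr s\<bar> \<le> real n powr s" if "0 \<le> s" for n x s
      using t that by (simp add: powr_mono2)
    have trunc: "(\<integral>\<omega>. t n (W \<omega>) powr r \<partial>M) \<le> C" for n
    proof -
      have B: "integrable M (\<lambda>\<omega>. t n (V \<omega>) powr r)" "integrable M (\<lambda>\<omega>. U \<omega> * t n (V \<omega>) powr (r - 1))"
        if "integrable M U" "V \<in> borel_measurable M" for U V
        using bdd_int(1)[of "\<lambda>x. t n x powr r" V "real n powr r" U] tp[of r n]
          bdd_int(2)[of "\<lambda>x. t n x powr (r - 1)" V "real n powr (r - 1)" U] tp[of "r - 1" n] that r
        by auto
      \<comment> \<open>The tangent inequality for the density \<open>U\<close> at the random point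
        \<open>t n (V \<omega>)\<close>, integrated.\<close>
      have le: "r * (\<integral>\<omega>. U \<omega> * t n (V \<omega>) powr (r - 1) \<partial>M) \<le> C + (r - 1) * (\<integral>\<omega>. t n (V \<omega>) powr r \<partial>M)"
        if U: "U \<in> evar_densities q M \<alpha>" and V[measurable]: "V \<in> borel_measurable M" for U V
      proof -
        note B = B[OF integrable_evar_density(1)[OF U] V]
        have "(\<integral>\<omega>. r * (U \<omega> * t n (V \<omega>) powr (r - 1)) \<partial>M) \<le> (\<integral>\<omega>. U \<omega> powr r + (r - 1) * t n (V \<omega>) powr r \<partial>M)"
          using B C(1)[OF U] powr_tangent[of "U _" "t n (V _)" r] U t r
          by (intro integral_mono) (auto simp: evar_densities_def mult_ac)
        also have "\<dots> = (\<integral>\<omega>. U \<omega> powr r \<partial>M) + (r - 1) * (\<integral>\<omega>. t n (V \<omega>) powr r \<partial>M)"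
          using B C(1)[OF U] by simp
        finally show ?thesis using C(2)[OF U] by simp
      qed
      have "g x * t n x powr (r - 1) = t n x powr r" for x
        using g0[of x] r by (cases "g x = 0") (auto simp: t_def powr_diff)
      then have "(\<integral>\<omega>. t n (W \<omega>) powr r \<partial>M) = (\<integral>\<omega>. g (W \<omega>) * t n (W \<omega>) powr (r - 1) \<partial>M)" by simp
      also have "\<dots> = l * (\<integral>\<omega>. Z1 \<omega> * t n (X \<omega>) powr (r - 1) \<partial>M) + (1 - l) * (\<integral>\<omega>. Z2 \<omega> * t n (Y \<omega>) powr (r - 1) \<partial>M)"
        using K[of "\<lambda>x. t n x powr (r - 1)"] B iZ by simp
      finally have eq: "(\<integral>\<omega>. t n (W \<omega>) powr r \<partial>M)
          = l * (\<integral>\<omega>. Z1 \<omega> * t n (X \<omega>) powr (r - 1) \<partial>M) + (1 - l) * (\<integral>\<omega>. Z2 \<omega> * t n (Y \<omega>) powr (r - 1) \<partial>M)" .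
      \<comment> \<open>Mixing the two instances of \<open>le\<close> gives r m \<le> C + (r - 1) m
        for m = E[t n(W)^r]; as m is finite, m \<le> C.\<close>
      have "r * (\<integral>\<omega>. t n (W \<omega>) powr r \<partial>M) = l * (r * (\<integral>\<omega>. Z1 \<omega> * t n (X \<omega>) powr (r - 1) \<partial>M))
          + (1 - l) * (r * (\<integral>\<omega>. Z2 \<omega> * t n (Y \<omega>) powr (r - 1) \<partial>M))"
        by (subst eq) (simp add: algebra_simps)
      also have "\<dots> \<le> l * (C + (r - 1) * (\<integral>\<omega>. t n (X \<omega>) powr r \<partial>M)) + (1 - l) * (C + (r - 1) * (\<integral>\<omega>. t n (Y \<omega>) powr r \<partial>M))"
        using l by (intro add_mono mult_left_mono le Z1 Z2) auto
      also have "\<dots> = C + (r - 1) * (\<integral>\<omega>. t n (W \<omega>) powr r \<partial>M)"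
        by (subst hmix[of "\<lambda>x. t n x powr r"]) (use B(1)[OF iZ(1)] in \<open>auto simp: algebra_simps\<close>)
      finally show ?thesis by (simp add: algebra_simps)
    qed
    \<comment> \<open>Monotone convergence removes the truncation: at each point \<open>t n\<close>
      equals \<open>g\<close> once \<open>n\<close> is large.\<close>
    have "(\<integral>\<^sup>+\<omega>. ennreal (Z \<omega> powr r) \<partial>M) = (\<integral>\<^sup>+\<omega>. (SUP n. ennreal (t n (W \<omega>) powr r)) \<partial>M)"
    proof (rule nn_integral_cong, rule antisym)
      fix \<omega>
      obtain n where "Z \<omega> \<le> real n" using real_arch_simple by blast
      then have "Z \<omega> = t n (W \<omega>)" by (simp add: t_def Z_def)
      then show "ennreal (Z \<omega> powr r) \<le> (SUP n. ennreal (t n (W \<omega>) powr r))" by (auto intro: SUP_upper)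
      show "(SUP n. ennreal (t n (W \<omega>) powr r)) \<le> ennreal (Z \<omega> powr r)"
        using g0 r by (intro SUP_least ennreal_leI powr_mono2) (auto simp: t_def Z_def)
    qed
    also have "\<dots> = (SUP n. \<integral>\<^sup>+\<omega>. ennreal (t n (W \<omega>) powr r) \<partial>M)"
    proof (rule nn_integral_monotone_convergence_SUP)
      show "incseq (\<lambda>n \<omega>. ennreal (t n (W \<omega>) powr r))"
        using g0 r by (intro monoI le_funI ennreal_leI powr_mono2) (auto simp: t_def)
    qed measurable
    also have "\<dots> \<le> ennreal C"
    proof (rule SUP_least)
      fix n
      have "integrable M (\<lambda>\<omega>. t n (W \<omega>) powr r)"
        using bdd_int(1)[of "\<lambda>x. t n x powr r" W "real n powr r" "\<lambda>_. 0"] tp[of r n] r by auto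
      then have "(\<integral>\<^sup>+\<omega>. ennreal (t n (W \<omega>) powr r) \<partial>M) = ennreal (\<integral>\<omega>. t n (W \<omega>) powr r \<partial>M)"
        by (intro nn_integral_eq_integral) auto
      then show "(\<integral>\<^sup>+\<omega>. ennreal (t n (W \<omega>) powr r) \<partial>M) \<le> ennreal C" using trunc by (simp add: ennreal_leI)
    qed
    finally show ?thesis using r by (simp add: C_def)
  qed
  show ?thesis
  proof
    show "Z \<in> evar_densities q M \<alpha>" using bound nnZ Z0 by (simp add: evar_densities_def)
    show "(\<integral>\<omega>. Z \<omega> * W \<omega> \<partial>M) = l * (\<integral>\<omega>. Z1 \<omega> * X \<omega> \<partial>M) + (1 - l) * (\<integral>\<omega>. Z2 \<omega> * Y \<omega> \<partial>M)"
      using K[of "\<lambda>x. x"] I1 I2 by (simp add: Z_def)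
  qed
qed


section \<open>Cash additivity, convexity and mixture concavity of EVaR\<close>

text \<open>Permits pulling a supremum out of a sum in \<open>EVaR_concave_in_mixtures\<close>.
  Below level 1 the expectation is a lower bound.\<close>

lemma EVaR_gt_MInf:
  assumes [measurable]: "X \<in> borel_measurable M" and "0 \<le> \<alpha>" "\<alpha> \<le> 1" and q: "1 < q"
  shows "EVaR q M \<alpha> X \<noteq> -\<infinity>"
proof (cases "\<alpha> = 1")
  case True
  show ?thesis
  proof
    assume "EVaR q M \<alpha> X = -\<infinity>"
    then have "esssup M (\<lambda>\<omega>. ereal (X \<omega>)) = -\<infinity>" using True by (simp add: EVaR_def)
    then have "AE \<omega> in M. False" using esssup_AE[of "\<lambda>\<omega>. ereal (X \<omega>)" M] by simp
    then show False by simp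
  qed
next
  case False
  then have a: "\<alpha> < 1" using assms by simp
  have "ereal (\<integral>\<omega>. 1 * X \<omega> \<partial>M) \<le> EVaR q M \<alpha> X"
    unfolding EVaR_eq_SUP_densities[OF assms(1,2) a q]
    by (rule SUP_upper2[OF one_in_evar_densities[OF assms(2) a q]]) simp
  then show ?thesis by auto
qed

lemma EVaR_1: "EVaR q M 1 X = esssup M (\<lambda>\<omega>. ereal (X \<omega>))"
  by (simp add: EVaR_def)

lemma EVaR_add_const:
  assumes p: "1 \<le> p" and q: "1 < q" "1 / ereal p + 1 / q = 1"
    and X: "X \<in> Lp p M" and \<alpha>: "0 \<le> \<alpha>" "\<alpha> \<le> 1"
  shows "EVaR q M \<alpha> (\<lambda>\<omega>. X \<omega> + m) = EVaR q M \<alpha> X + ereal m"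
proof (cases "\<alpha> = 1")
  case True
  \<comment> \<open>One inequality is subadditivity of the essential supremum; the converse is the
    same inequality for \<open>X + m\<close> shifted by \<open>- m\<close>.\<close>
  have le: "esssup M (\<lambda>\<omega>. ereal (V \<omega> + k)) \<le> esssup M (\<lambda>\<omega>. ereal (V \<omega>)) + ereal k"
    if [measurable]: "V \<in> borel_measurable M" for V k
    using esssup_add[of M "\<lambda>\<omega>. ereal (V \<omega>)" "\<lambda>_. ereal k"]
    by (simp add: esssup_const emeasure_space_1)
  have [measurable]: "X \<in> borel_measurable M" using X by (simp add: Lp_def)
  have "esssup M (\<lambda>\<omega>. ereal (X \<omega>)) \<le> esssup M (\<lambda>\<omega>. ereal (X \<omega> + m)) + ereal (- m)"
    using le[of "\<lambda>\<omega>. X \<omega> + m" "- m"] by simp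
  then have "esssup M (\<lambda>\<omega>. ereal (X \<omega>)) + ereal m \<le> esssup M (\<lambda>\<omega>. ereal (X \<omega> + m))"
    by (cases "esssup M (\<lambda>\<omega>. ereal (X \<omega>))"; cases "esssup M (\<lambda>\<omega>. ereal (X \<omega> + m))") auto
  then show ?thesis using le[of X m] True by (simp add: EVaR_1 antisym)
next
  case False
  then have a: "\<alpha> < 1" using \<alpha> by simp
  have [measurable]: "X \<in> borel_measurable M" using X by (simp add: Lp_def)
  have ne: "evar_densities q M \<alpha> \<noteq> {}" using one_in_evar_densities[OF \<alpha>(1) a q(1)] by blast
  have "(\<integral>\<omega>. Z \<omega> * (X \<omega> + m) \<partial>M) = (\<integral>\<omega>. Z \<omega> * X \<omega> \<partial>M) + m" if "Z \<in> evar_densities q M \<alpha>" for Z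
    using integrable_mult_evar_density[OF p q that X] integrable_evar_density[OF that]
    by (simp add: distrib_left)
  then show ?thesis
    using ne by (simp add: EVaR_eq_SUP_densities \<alpha> a q SUP_ereal_add_left[symmetric])
qed

lemma EVaR_convex:
  assumes p: "1 \<le> p" and q: "1 < q" "1 / ereal p + 1 / q = 1"
    and X: "X \<in> Lp p M" and Y: "Y \<in> Lp p M" and \<alpha>: "0 \<le> \<alpha>" "\<alpha> \<le> 1" and l: "l \<in> {0..1}"
  shows "EVaR q M \<alpha> (\<lambda>\<omega>. l * X \<omega> + (1 - l) * Y \<omega>)
    \<le> ereal l * EVaR q M \<alpha> X + ereal (1 - l) * EVaR q M \<alpha> Y"
proof (cases "\<alpha> = 1")
  case True
  have [measurable]: "X \<in> borel_measurable M" "Y \<in> borel_measurable M" using X Y by (simp_all add: Lp_def)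
  \<comment> \<open>At the end points a weight 0 annihilates even an infinite value; in between both
    weights are positive and can be pulled out of the essential supremum.\<close>
  consider "l = 0" | "l = 1" | "0 < l" "l < 1" using l by fastforce
  then show ?thesis
  proof cases
    case 3
    have "esssup M (\<lambda>\<omega>. ereal (l * X \<omega> + (1 - l) * Y \<omega>))
        \<le> esssup M (\<lambda>\<omega>. ereal l * ereal (X \<omega>)) + esssup M (\<lambda>\<omega>. ereal (1 - l) * ereal (Y \<omega>))"
      using esssup_add[of M "\<lambda>\<omega>. ereal l * ereal (X \<omega>)" "\<lambda>\<omega>. ereal (1 - l) * ereal (Y \<omega>)"] by simp
    then show ?thesis using 3 True by (simp add: EVaR_1 esssup_cmult del: times_ereal.simps)
  qed (simp_all add: zero_ereal_def[symmetric] one_ereal_def[symmetric])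
next
  case False
  then have a: "\<alpha> < 1" using \<alpha> by simp
  have m[measurable]: "X \<in> borel_measurable M" "Y \<in> borel_measurable M" using X Y by (simp_all add: Lp_def)
  have "EVaR q M \<alpha> (\<lambda>\<omega>. l * X \<omega> + (1 - l) * Y \<omega>)
      = (SUP Z\<in>evar_densities q M \<alpha>. ereal (\<integral>\<omega>. Z \<omega> * (l * X \<omega> + (1 - l) * Y \<omega>) \<partial>M))"
    by (rule EVaR_eq_SUP_densities[OF _ \<alpha>(1) a q(1)]) measurable
  also have "\<dots> \<le> ereal l * EVaR q M \<alpha> X + ereal (1 - l) * EVaR q M \<alpha> Y"
  proof (rule SUP_least)
    fix Z assume Z: "Z \<in> evar_densities q M \<alpha>"
    note I = integrable_mult_evar_density[OF p q Z X] integrable_mult_evar_density[OF p q Z Y]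
    have "(\<integral>\<omega>. Z \<omega> * (l * X \<omega> + (1 - l) * Y \<omega>) \<partial>M) = (\<integral>\<omega>. l * (Z \<omega> * X \<omega>) + (1 - l) * (Z \<omega> * Y \<omega>) \<partial>M)"
      by (simp add: algebra_simps)
    also have "\<dots> = l * (\<integral>\<omega>. Z \<omega> * X \<omega> \<partial>M) + (1 - l) * (\<integral>\<omega>. Z \<omega> * Y \<omega> \<partial>M)"
      using I by simp
    finally have "ereal (\<integral>\<omega>. Z \<omega> * (l * X \<omega> + (1 - l) * Y \<omega>) \<partial>M)
        = ereal l * ereal (\<integral>\<omega>. Z \<omega> * X \<omega> \<partial>M) + ereal (1 - l) * ereal (\<integral>\<omega>. Z \<omega> * Y \<omega> \<partial>M)" by simp
    also have "\<dots> \<le> ereal l * EVaR q M \<alpha> X + ereal (1 - l) * EVaR q M \<alpha> Y"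
      using l Z \<alpha> a q
      by (intro add_mono ereal_mult_left_mono) (auto simp: EVaR_eq_SUP_densities intro!: SUP_upper2[OF Z])
    finally show "ereal (\<integral>\<omega>. Z \<omega> * (l * X \<omega> + (1 - l) * Y \<omega>) \<partial>M)
        \<le> ereal l * EVaR q M \<alpha> X + ereal (1 - l) * EVaR q M \<alpha> Y" .
  qed
  finally show ?thesis .
qed

text \<open>Below level 1, any two densities for \<open>X\<close> and \<open>Y\<close> combine into
  one for \<open>W\<close>. At level 1, the essential supremum of \<open>W\<close> dominates that of
  each component of positive weight.\<close>

lemma EVaR_concave_in_mixtures:
  assumes p: "1 \<le> p" and q: "1 < q" "1 / ereal p + 1 / q = 1"
    and X: "X \<in> Lp p M" and Y: "Y \<in> Lp p M" and W: "W \<in> Lp p M"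
    and \<alpha>: "0 \<le> \<alpha>" "\<alpha> \<le> 1" and l: "l \<in> {0..1}"
    and mix: "distr M borel W = mixture l (distr M borel X) (distr M borel Y)"
  shows "ereal l * EVaR q M \<alpha> X + ereal (1 - l) * EVaR q M \<alpha> Y \<le> EVaR q M \<alpha> W"
proof (cases "\<alpha> = 1")
  case True
  have m[measurable]: "X \<in> borel_measurable M" "Y \<in> borel_measurable M" "W \<in> borel_measurable M"
    using X Y W by (simp_all add: Lp_def)
  define E where "E = esssup M (\<lambda>\<omega>. ereal (W \<omega>))"
  \<comment> \<open>The values above the essential supremum of \<open>W\<close> form a null set of
    its law, hence of each component law of positive weight.\<close>
  define B where "B = {x. E < ereal x}"
  have [measurable]: "B \<in> sets borel" unfolding B_def by measurable
  have "AE \<omega> in M. W \<omega> \<notin> B"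
    using esssup_AE[of "\<lambda>\<omega>. ereal (W \<omega>)" M] by eventually_elim (simp add: B_def E_def)
  then have "emeasure (distr M borel W) B = 0"
    by (subst emeasure_distr) (auto simp: AE_iff_measurable[OF _ refl] vimage_def Int_def conj_commute)
  then have "ennreal l * emeasure (distr M borel X) B + ennreal (1 - l) * emeasure (distr M borel Y) B = 0"
    unfolding mix by (subst (asm) emeasure_mixture) auto
  then have z: "0 < l \<Longrightarrow> emeasure (distr M borel X) B = 0" "l < 1 \<Longrightarrow> emeasure (distr M borel Y) B = 0"
    by auto
  have le: "esssup M (\<lambda>\<omega>. ereal (V \<omega>)) \<le> E"
    if [measurable]: "V \<in> borel_measurable M" and "emeasure (distr M borel V) B = 0" for V
  proof (rule esssup_I)
    have "AE \<omega> in M. V \<omega> \<notin> B"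
      using that by (subst AE_iff_measurable[OF _ refl]) (auto simp: emeasure_distr vimage_def Int_def conj_commute)
    then show "AE \<omega> in M. ereal (V \<omega>) \<le> E" by eventually_elim (simp add: B_def)
  qed measurable
  consider "l = 0" | "l = 1" | "0 < l" "l < 1" using l by fastforce
  then show ?thesis
  proof cases
    case 1 then show ?thesis using le[OF m(2) z(2)] True
      by (simp add: EVaR_1 E_def zero_ereal_def[symmetric] one_ereal_def[symmetric])
  next
    case 2 then show ?thesis using le[OF m(1) z(1)] True
      by (simp add: EVaR_1 E_def zero_ereal_def[symmetric] one_ereal_def[symmetric])
  next
    case 3
    then have "ereal l * esssup M (\<lambda>\<omega>. ereal (X \<omega>)) + ereal (1 - l) * esssup M (\<lambda>\<omega>. ereal (Y \<omega>)) \<le> ereal l * E + ereal (1 - l) * E"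
      using z le m by (intro add_mono ereal_mult_left_mono) auto
    also have "\<dots> = (ereal l + ereal (1 - l)) * E" using 3 by (intro ereal_left_distrib[symmetric]) auto
    also have "\<dots> = E" by (simp add: one_ereal_def[symmetric])
    finally show ?thesis using True by (simp add: EVaR_1 E_def)
  qed
next
  case False
  then have a: "\<alpha> < 1" using \<alpha> by simp
  have m[measurable]: "X \<in> borel_measurable M" "Y \<in> borel_measurable M" "W \<in> borel_measurable M"
    using X Y W by (simp_all add: Lp_def)
  let ?D = "evar_densities q M \<alpha>"
  let ?E = "\<lambda>Z V. ereal (\<integral>\<omega>. Z \<omega> * V \<omega> \<partial>M)"
  have ne: "?D \<noteq> {}" using one_in_evar_densities[OF \<alpha>(1) a q(1)] by blast
  note eq = EVaR_eq_SUP_densities[OF _ \<alpha>(1) a q(1)]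
  have 1: "ereal l * ?E Z1 X + ereal (1 - l) * ?E Z2 Y \<le> EVaR q M \<alpha> W"
    if Z: "Z1 \<in> ?D" "Z2 \<in> ?D" for Z1 Z2
  proof -
    obtain Z where "Z \<in> ?D"
      "(\<integral>\<omega>. Z \<omega> * W \<omega> \<partial>M) = l * (\<integral>\<omega>. Z1 \<omega> * X \<omega> \<partial>M) + (1 - l) * (\<integral>\<omega>. Z2 \<omega> * Y \<omega> \<partial>M)"
      using evar_densities_mixture[OF m l q(1) mix Z integrable_mult_evar_density[OF p q Z(1) X]
        integrable_mult_evar_density[OF p q Z(2) Y]] by blast
    then show ?thesis unfolding eq[OF m(3)] by (intro SUP_upper2[of Z]) auto
  qed
  have sup: "ereal s * EVaR q M \<alpha> V = (SUP Z\<in>?D. ereal s * ?E Z V)"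
    if "0 \<le> s" "V \<in> borel_measurable M" for s V
    unfolding eq[OF that(2)] by (rule Sup_ereal_mult_left'[OF ne that(1)])
  \<comment> \<open>The pair bound holds for independent choices, so the supremum is taken over
    \<open>Z2\<close> with \<open>Z1\<close> fixed, then over \<open>Z1\<close>. Each time the fixed
    summand must differ from \<open>-\<infinity>\<close>.\<close>
  have "ereal l * ?E Z1 X + ereal (1 - l) * EVaR q M \<alpha> Y \<le> EVaR q M \<alpha> W" if "Z1 \<in> ?D" for Z1
    using l 1[OF that] ne by (subst sup) (auto simp: SUP_ereal_add_right[symmetric] intro!: SUP_least)
  moreover have "ereal (1 - l) * EVaR q M \<alpha> Y \<noteq> -\<infinity>"
    using EVaR_gt_MInf[OF m(2) \<alpha> q(1)] l by (cases "EVaR q M \<alpha> Y") auto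
  ultimately show ?thesis
    using l ne by (subst sup) (auto simp: SUP_ereal_add_left[symmetric] intro!: SUP_least)
qed

section \<open>EVaR of two-valued random variables\<close>

lemma affine_indicator_in_Lp:
  assumes [measurable]: "A \<in> events" and "1 \<le> p"
  shows "(\<lambda>\<omega>. x + d * indicator A \<omega>) \<in> Lp p M"
proof -
  have "integrable M (\<lambda>\<omega>. \<bar>x + d * indicator A \<omega>\<bar> powr p)"
    using assms(2) by (intro integrable_const_bound[of _ "(\<bar>x\<bar> + \<bar>d\<bar>) powr p"])
      (auto simp: indicator_def intro!: powr_mono2)
  then show ?thesis by (simp add: Lp_def)
qed

text \<open>Under the conditional measure given \<open>A\<close> the variable equals
  \<open>x + d\<close>, and \<open>1 - \<alpha> \<le> prob A\<close> makes this measure admissible.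
  At level 1 it suffices that \<open>A\<close> is not a null set.\<close>

lemma EVaR_affine_indicator_ge:
  assumes A[measurable]: "A \<in> events" and \<alpha>: "0 \<le> \<alpha>" "\<alpha> \<le> 1" and q: "1 < q"
    and PA: "1 - \<alpha> \<le> prob A" "0 < prob A"
  shows "ereal (x + d) \<le> EVaR q M \<alpha> (\<lambda>\<omega>. x + d * indicator A \<omega>)"
proof (cases "\<alpha> = 1")
  case True
  let ?E = "esssup M (\<lambda>\<omega>. ereal (x + d * indicator A \<omega>))"
  have "ereal (x + d) \<le> ?E"
  proof (rule ccontr)
    assume *: "\<not> ereal (x + d) \<le> ?E"
    have "AE \<omega> in M. ereal (x + d * indicator A \<omega>) \<le> ?E" by (rule esssup_AE)
    then have "AE \<omega> in M. \<omega> \<notin> A" by eventually_elim (use * in auto)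
    then have "A \<in> null_sets M" using AE_iff_null_sets[OF A] by simp
    then have "prob A = 0" by (rule measure_eq_0_null_sets)
    then show False using PA by simp
  qed
  then show ?thesis using True by (simp add: EVaR_1)
next
  case False
  then have a: "\<alpha> < 1" using \<alpha> by simp
  have ind: "integrable M (indicator A :: 'a \<Rightarrow> real)"
    by (intro integrable_real_indicator A) (simp add: emeasure_eq_measure)
  have "(\<integral>\<omega>. indicator A \<omega> / prob A * (x + d * indicator A \<omega>) \<partial>M) = (\<integral>\<omega>. (x + d) / prob A * indicator A \<omega> \<partial>M)"
    by (intro Bochner_Integration.integral_cong) (auto simp: indicator_def)
  also have "\<dots> = x + d" using PA by simp
  finally have *: "(\<integral>\<omega>. indicator A \<omega> / prob A * (x + d * indicator A \<omega>) \<partial>M) = x + d" .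
  have "(\<lambda>\<omega>. x + d * indicator A \<omega>) \<in> borel_measurable M" by measurable
  note eq = EVaR_eq_SUP_densities[OF this \<alpha>(1) a q]
  show ?thesis
    unfolding eq by (rule SUP_upper2[OF indicator_in_evar_densities[OF A \<alpha>(1) a q PA(1)]]) (simp only: * order_refl)
qed

lemma EVaR_affine_indicator_le:
  assumes p: "1 \<le> p" and q: "1 < q" "1 / ereal p + 1 / q = 1"
    and A[measurable]: "A \<in> events" and \<alpha>: "0 \<le> \<alpha>" "\<alpha> < 1" and d: "0 \<le> d"
  shows "EVaR q M \<alpha> (\<lambda>\<omega>. x + d * indicator A \<omega>) \<le> ereal (x + d * (1 - (1 - prob A / (1 - \<alpha>)) / p))"
proof -
  have "(\<lambda>\<omega>. x + d * indicator A \<omega>) \<in> borel_measurable M" by measurable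
  note eq = EVaR_eq_SUP_densities[OF this \<alpha> q(1)]
  show ?thesis unfolding eq
  proof (rule SUP_least)
    fix Z assume Z: "Z \<in> evar_densities q M \<alpha>"
    note iZ = integrable_evar_density[OF Z]
    have int: "integrable M (\<lambda>\<omega>. Z \<omega> * indicator A \<omega>)"
      using iZ(1) integrable_real_mult_indicator[OF A] by (simp add: mult.commute)
    have "(\<integral>\<omega>. Z \<omega> * (x + d * indicator A \<omega>) \<partial>M) = (\<integral>\<omega>. x * Z \<omega> + d * (Z \<omega> * indicator A \<omega>) \<partial>M)"
      by (simp add: algebra_simps)
    also have "\<dots> = x + d * (\<integral>\<omega>. Z \<omega> * indicator A \<omega> \<partial>M)" using int iZ by simp
    finally show "ereal (\<integral>\<omega>. Z \<omega> * (x + d * indicator A \<omega>) \<partial>M) \<le> ereal (x + d * (1 - (1 - prob A / (1 - \<alpha>)) / p))"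
      using integral_evar_density_indicator_le[OF p q Z \<alpha>(2) A] d by (simp add: mult_left_mono)
  qed
qed

lemma EVaR_affine_indicator_le_max:
  assumes A[measurable]: "A \<in> events" and \<alpha>: "0 \<le> \<alpha>" "\<alpha> \<le> 1" and q: "1 < q" and d: "0 \<le> d"
  shows "EVaR q M \<alpha> (\<lambda>\<omega>. x + d * indicator A \<omega>) \<le> ereal (x + d)"
proof (cases "\<alpha> = 1")
  case True
  then show ?thesis using d by (auto simp: EVaR_1 indicator_def intro!: esssup_I)
next
  case False
  then have a: "\<alpha> < 1" using \<alpha> by simp
  have m: "(\<lambda>\<omega>. x + d * indicator A \<omega>) \<in> borel_measurable M" by measurable
  show ?thesis unfolding EVaR_eq_SUP_densities[OF m \<alpha>(1) a q]
  proof (rule SUP_least)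
    fix Z assume Z: "Z \<in> evar_densities q M \<alpha>"
    note iZ = integrable_evar_density[OF Z]
    have Z0: "0 \<le> Z \<omega>" for \<omega> using Z by (simp add: evar_densities_def)
    have int: "integrable M (\<lambda>\<omega>. Z \<omega> * indicator A \<omega>)"
      using iZ(1) integrable_real_mult_indicator[OF A] by (simp add: mult.commute)
    then have "integrable M (\<lambda>\<omega>. Z \<omega> * (x + d * indicator A \<omega>))"
      using iZ(1) by (simp add: distrib_left mult.left_commute)
    moreover have "Z \<omega> * (x + d * indicator A \<omega>) \<le> Z \<omega> * (x + d)" for \<omega>
      using Z0[of \<omega>] d by (intro mult_left_mono) (auto simp: indicator_def)
    ultimately have "(\<integral>\<omega>. Z \<omega> * (x + d * indicator A \<omega>) \<partial>M) \<le> (\<integral>\<omega>. Z \<omega> * (x + d) \<partial>M)"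
      using iZ by (intro integral_mono) auto
    then show "ereal (\<integral>\<omega>. Z \<omega> * (x + d * indicator A \<omega>) \<partial>M) \<le> ereal (x + d)" using iZ by simp
  qed
qed

section \<open>Constant \<open>\<Lambda>\<close>, and laws of two-valued random variables\<close>

lemma Lambda_EVaR_const:
  assumes "\<And>x. \<Lambda> x = c"
  shows "Lambda_EVaR q M \<Lambda> X = EVaR q M c X"
proof (rule antisym)
  show "Lambda_EVaR q M \<Lambda> X \<le> EVaR q M c X"
    unfolding Lambda_EVaR_def by (rule SUP_least) (simp add: assms)
  show "EVaR q M c X \<le> Lambda_EVaR q M \<Lambda> X"
  proof (rule ereal_le_real)
    fix z assume "Lambda_EVaR q M \<Lambda> X \<le> ereal z"
    then have le: "min (EVaR q M c X) (ereal x) \<le> ereal z" for x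
      unfolding Lambda_EVaR_def by (auto simp: assms SUP_le_iff)
    \<comment> \<open>At \<open>x = z + 1\<close> the minimum cannot be its second entry, so the
      bound falls on EVaR, infinite values included.\<close>
    show "EVaR q M c X \<le> ereal z" using le[of "z + 1"] by (auto simp: min_def split: if_splits)
  qed
qed

lemma emeasure_distr_affine_indicator:
  fixes x d :: real
  assumes A[measurable]: "A \<in> events" and B: "B \<in> sets borel"
  shows "emeasure (distr M borel (\<lambda>\<omega>. x + d * indicator A \<omega>)) B
    = ennreal (prob A * indicator B (x + d) + (1 - prob A) * indicator B x)"
proof -
  let ?V = "\<lambda>\<omega>. x + d * indicator A \<omega>"
  have "emeasure (distr M borel ?V) B = emeasure M (?V -` B \<inter> space M)"
    by (rule emeasure_distr[OF _ B]) measurable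
  also have "?V -` B \<inter> space M = (if x + d \<in> B then A else {}) \<union> (if x \<in> B then space M - A else {})"
  proof (rule set_eqI)
    fix \<omega>
    show "\<omega> \<in> ?V -` B \<inter> space M \<longleftrightarrow>
        \<omega> \<in> (if x + d \<in> B then A else {}) \<union> (if x \<in> B then space M - A else {})"
      using sets.sets_into_space[OF A] by (cases "\<omega> \<in> A") auto
  qed
  also have "emeasure M \<dots> = ennreal (prob A * indicator B (x + d) + (1 - prob A) * indicator B x)"
    using prob_compl[OF A] sets.sets_into_space[OF A]
    by (auto simp: emeasure_eq_measure Un_absorb1 prob_space ennreal_plus[symmetric] simp del: ennreal_plus)
  finally show ?thesis .
qed

lemma distr_affine_indicator_compact:
  assumes A[measurable]: "A \<in> events"
  shows "distr M borel (\<lambda>\<omega>. x + d * indicator A \<omega>) \<in> compact_distributions"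
proof -
  have "real_distribution (distr M borel (\<lambda>\<omega>. x + d * indicator A \<omega>))"
    by (rule real_distribution_distr) measurable
  moreover have "compact {x, x + d}" by (simp add: finite_imp_compact)
  moreover have "emeasure (distr M borel (\<lambda>\<omega>. x + d * indicator A \<omega>)) {x, x + d} = 1"
    by (subst emeasure_distr_affine_indicator) auto
  ultimately show ?thesis unfolding compact_distributions_def by blast
qed

text \<open>The law is affine in the probability of the event, and
  \<open>indicator (space M)\<close> writes the point mass at \<open>x + d\<close> as the case of
  probability 1.\<close>

lemma distr_affine_indicator_mixture:
  assumes [measurable]: "A \<in> events" "A' \<in> events" and l: "l \<in> {0..1}"
    and P: "prob A = l * prob A' + (1 - l)"
  shows "distr M borel (\<lambda>\<omega>. x + d * indicator A \<omega>)
    = mixture l (distr M borel (\<lambda>\<omega>. x + d * indicator A' \<omega>)) (distr M borel (\<lambda>\<omega>. x + d * indicator (space M) \<omega>))"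
proof (rule measure_eqI)
  fix B assume "B \<in> sets (distr M borel (\<lambda>\<omega>. x + d * indicator A \<omega>))"
  then have B: "B \<in> sets borel" by simp
  define u where "u S = prob S * indicator B (x + d) + (1 - prob S) * indicator B x" for S
  have u0: "0 \<le> u S" for S by (simp add: u_def)
  have "u A = l * u A' + (1 - l) * u (space M)" by (simp add: u_def P prob_space algebra_simps)
  then have "ennreal (u A) = ennreal l * ennreal (u A') + ennreal (1 - l) * ennreal (u (space M))"
    using l u0 by (simp add: ennreal_mult' ennreal_plus)
  then show "emeasure (distr M borel (\<lambda>\<omega>. x + d * indicator A \<omega>)) B
      = emeasure (mixture l (distr M borel (\<lambda>\<omega>. x + d * indicator A' \<omega>)) (distr M borel (\<lambda>\<omega>. x + d * indicator (space M) \<omega>))) B"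
    using B by (simp add: emeasure_mixture emeasure_distr_affine_indicator u_def)
qed simp


section \<open>Failure of each property for non-constant \<open>\<Lambda>\<close>\<close>

context
  fixes p :: real and q :: ereal and \<Lambda> :: "real \<Rightarrow> real"
  assumes p: "1 \<le> p" and q: "1 < q" "1 / ereal p + 1 / q = 1"
    and \<Lambda>: "\<And>x. \<Lambda> x \<in> {0..1}" and anti: "antimono \<Lambda>"
begin

text \<open>The term of the supremum at \<open>y\<close> is a minimum whose two entries are both at
  least \<open>y\<close>.\<close>

lemma Lambda_EVaR_affine_indicator_ge:
  assumes "A \<in> events" "1 - \<Lambda> y \<le> prob A" "0 < prob A" "y \<le> x + d"
  shows "ereal y \<le> Lambda_EVaR q M \<Lambda> (\<lambda>\<omega>. x + d * indicator A \<omega>)"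
proof -
  have "ereal (x + d) \<le> EVaR q M (\<Lambda> y) (\<lambda>\<omega>. x + d * indicator A \<omega>)"
    using assms \<Lambda>[of y] by (intro EVaR_affine_indicator_ge q) auto
  then have "ereal y \<le> EVaR q M (\<Lambda> y) (\<lambda>\<omega>. x + d * indicator A \<omega>)"
    using assms(4) by (auto intro: order_trans[rotated])
  then show ?thesis unfolding Lambda_EVaR_def by (intro SUP_upper2[of y]) auto
qed

text \<open>Terms with \<open>z \<le> y\<close> are capped by \<open>z\<close> itself. For
  \<open>z > y\<close> monotonicity gives \<open>\<Lambda> z \<le> \<Lambda> y\<close>, and the
  bound on EVaR increases with the level.\<close>

lemma Lambda_EVaR_affine_indicator_le:
  assumes A: "A \<in> events" and y: "\<Lambda> y < 1" and d: "0 \<le> d"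
    and le: "x + d * (1 - (1 - prob A / (1 - \<Lambda> y)) / p) \<le> y"
  shows "Lambda_EVaR q M \<Lambda> (\<lambda>\<omega>. x + d * indicator A \<omega>) \<le> ereal y"
  unfolding Lambda_EVaR_def
proof (rule SUP_least)
  fix z
  let ?V = "\<lambda>\<omega>. x + d * indicator A \<omega>"
  show "min (EVaR q M (\<Lambda> z) ?V) (ereal z) \<le> ereal y"
  proof (cases "z \<le> y")
    case False
    then have z: "\<Lambda> z \<le> \<Lambda> y" using anti by (simp add: antimonoD)
    have "EVaR q M (\<Lambda> z) ?V \<le> ereal (x + d * (1 - (1 - prob A / (1 - \<Lambda> z)) / p))"
      using \<Lambda>[of z] z y by (intro EVaR_affine_indicator_le p q A d) auto
    also have "x + d * (1 - (1 - prob A / (1 - \<Lambda> z)) / p) \<le> x + d * (1 - (1 - prob A / (1 - \<Lambda> y)) / p)"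
      using z y p d by (intro add_left_mono mult_left_mono diff_left_mono divide_right_mono) (auto simp: frac_le)
    finally show ?thesis using le by (auto intro: min.coboundedI1 order_trans)
  qed (auto intro: min.coboundedI2)
qed

lemma Lambda_EVaR_affine_indicator_le_max:
  assumes "A \<in> events" "0 \<le> d"
  shows "Lambda_EVaR q M \<Lambda> (\<lambda>\<omega>. x + d * indicator A \<omega>) \<le> ereal (x + d)"
  unfolding Lambda_EVaR_def
proof (rule SUP_least)
  fix z
  show "min (EVaR q M (\<Lambda> z) (\<lambda>\<omega>. x + d * indicator A \<omega>)) (ereal z) \<le> ereal (x + d)"
    using EVaR_affine_indicator_le_max[OF assms(1) _ _ q(1) assms(2), of "\<Lambda> z" x] \<Lambda>[of z]
    by (auto intro: min.coboundedI1)
qed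

lemma not_constant_witness:
  assumes "atomless M" and "\<not> (\<exists>c. \<forall>x. \<Lambda> x = c)"
  obtains a b A where "a < b" "A \<in> events" "1 - \<Lambda> a < prob A" "prob A < 1 - \<Lambda> b"
proof -
  obtain x y where "\<Lambda> x \<noteq> \<Lambda> y" using assms(2) by metis
  then obtain a b where ab: "a < b" "\<Lambda> b < \<Lambda> a"
    using anti by (metis antimonoD linorder_neqE_linordered_idom order_le_less)
  then obtain A where "A \<in> events" "1 - \<Lambda> a < prob A" "prob A < 1 - \<Lambda> b"
    using exists_measure_between[OF assms(1), of "1 - \<Lambda> a" "1 - \<Lambda> b"] \<Lambda>[of a] \<Lambda>[of b] by auto
  then show ?thesis using that ab by blast
qed

text \<open>Here \<open>t\<close> bounds the mass that measures admissible at level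
  \<open>\<Lambda> b\<close> give to \<open>A\<close>. From the first variable to the second the
  shift grows by \<open>b - a + (1 - t)\<close>, but the risk by at most
  \<open>b - a\<close>.\<close>

lemma shifted_indicator_bounds:
  assumes A: "A \<in> events" "1 - \<Lambda> a < prob A" "prob A < 1 - \<Lambda> b"
  obtains t where "t < 1"
    "ereal a \<le> Lambda_EVaR q M \<Lambda> (\<lambda>\<omega>. (a - 1) + 1 * indicator A \<omega>)"
    "Lambda_EVaR q M \<Lambda> (\<lambda>\<omega>. (b - t) + 1 * indicator A \<omega>) \<le> ereal b"
proof -
  have b: "\<Lambda> b < 1" using A measure_nonneg[of M A] by linarith
  have a: "0 < prob A" using A(2) \<Lambda>[of a] by auto
  define t where "t = 1 - (1 - prob A / (1 - \<Lambda> b)) / p"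
  have "prob A / (1 - \<Lambda> b) < 1" using A b by simp
  then have "t < 1" using p by (simp add: t_def)
  moreover have "ereal a \<le> Lambda_EVaR q M \<Lambda> (\<lambda>\<omega>. (a - 1) + 1 * indicator A \<omega>)"
    using A a by (intro Lambda_EVaR_affine_indicator_ge) auto
  moreover have "Lambda_EVaR q M \<Lambda> (\<lambda>\<omega>. (b - t) + 1 * indicator A \<omega>) \<le> ereal b"
    using A b by (intro Lambda_EVaR_affine_indicator_le) (auto simp: t_def)
  ultimately show ?thesis using that by blast
qed

lemma cash_additive_imp_constant:
  assumes "atomless M" and cash: "cash_additive p M (Lambda_EVaR q M \<Lambda>)"
  shows "\<exists>c. \<forall>x. \<Lambda> x = c"
proof (rule ccontr)
  assume "\<not> ?thesis"
  then obtain a b A where A: "a < b" "A \<in> events" "1 - \<Lambda> a < prob A" "prob A < 1 - \<Lambda> b"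
    using not_constant_witness[OF assms(1)] by blast
  obtain t where t: "t < 1"
    "ereal a \<le> Lambda_EVaR q M \<Lambda> (\<lambda>\<omega>. (a - 1) + 1 * indicator A \<omega>)"
    "Lambda_EVaR q M \<Lambda> (\<lambda>\<omega>. (b - t) + 1 * indicator A \<omega>) \<le> ereal b"
    using shifted_indicator_bounds[OF A(2-4)] by blast
  have "(indicator A :: 'a \<Rightarrow> real) \<in> Lp p M" using affine_indicator_in_Lp[OF A(2) p, of 0 1] by simp
  then have "Lambda_EVaR q M \<Lambda> (\<lambda>\<omega>. m + 1 * indicator A \<omega>) = Lambda_EVaR q M \<Lambda> (indicator A) + ereal m" for m
    using cash unfolding cash_additive_def by (auto simp: add.commute)
  \<comment> \<open>With r the risk of the indicator, the bounds become r + a - 1 \<ge> a and r + b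
    - t \<le> b, that is 1 \<le> r \<le> t; an infinite r violates one of them.\<close>
  note t(2,3)[unfolded this]
  then show False using \<open>t < 1\<close> by (cases "Lambda_EVaR q M \<Lambda> (indicator A)") auto
qed

lemma convex_imp_constant:
  assumes "atomless M" and convex: "convex_functional p M (Lambda_EVaR q M \<Lambda>)"
  shows "\<exists>c. \<forall>x. \<Lambda> x = c"
proof (rule ccontr)
  assume "\<not> ?thesis"
  then obtain a b A where A: "a < b" "A \<in> events" "1 - \<Lambda> a < prob A" "prob A < 1 - \<Lambda> b"
    using not_constant_witness[OF assms(1)] by blast
  obtain t where t: "t < 1"
    "ereal a \<le> Lambda_EVaR q M \<Lambda> (\<lambda>\<omega>. (a - 1) + 1 * indicator A \<omega>)"
    "Lambda_EVaR q M \<Lambda> (\<lambda>\<omega>. (b - t) + 1 * indicator A \<omega>) \<le> ereal b"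
    using shifted_indicator_bounds[OF A(2-4)] by blast
  \<comment> \<open>Chosen so that the variable shifted by \<open>a - 1\<close> is the midpoint of
    those shifted by \<open>n\<close> and \<open>b - t\<close>. Convexity then yields a \<le> (n + 1
    + b) / 2 = a - (1 - t) / 2.\<close>
  define n where "n = 2 * (a - 1) - (b - t)"
  let ?X = "\<lambda>m \<omega>. m + 1 * indicator A \<omega> :: real"
  have "(\<lambda>\<omega>. 1/2 * ?X n \<omega> + (1 - 1/2) * ?X (b - t) \<omega>) = ?X (a - 1)"
    by (simp add: fun_eq_iff n_def field_simps)
  moreover have "?X m \<in> Lp p M" for m by (rule affine_indicator_in_Lp[OF A(2) p])
  ultimately have "Lambda_EVaR q M \<Lambda> (?X (a - 1))
      \<le> ereal (1/2) * Lambda_EVaR q M \<Lambda> (?X n) + ereal (1 - 1/2) * Lambda_EVaR q M \<Lambda> (?X (b - t))"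
    using convex[unfolded convex_functional_def, rule_format, of "?X n" "?X (b - t)" "1/2"] by simp
  also have "\<dots> \<le> ereal (1/2) * ereal (n + 1) + ereal (1 - 1/2) * ereal b"
    using t Lambda_EVaR_affine_indicator_le_max[OF A(2), of 1 n]
    by (intro add_mono ereal_mult_left_mono) auto
  finally have "ereal a \<le> ereal (1/2) * ereal (n + 1) + ereal (1 - 1/2) * ereal b"
    using t(2) order_trans by blast
  then show False using \<open>t < 1\<close> by (simp add: n_def field_simps)
qed

text \<open>As \<open>d\<close> grows with \<open>N\<close> fixed, the law of \<open>N - d + d 1\<^sub>A\<close> moves its lower atom to
  \<open>-\<infinity>\<close>. Its risk stays \<open>\<ge> a\<close> for the smaller event but becomes \<open>\<le> b\<close> for the larger one. The
  second law is a mixture of the first and the point mass at \<open>N\<close>, with a weight that does not depend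
  on \<open>N\<close>, so a large \<open>N\<close> violates concavity.\<close>

lemma concave_in_mixtures_imp_constant:
  assumes "atomless M" and concave: "concave_in_mixtures p M (Lambda_EVaR q M \<Lambda>)"
  shows "\<exists>c. \<forall>x. \<Lambda> x = c"
proof (rule ccontr)
  assume "\<not> ?thesis"
  then obtain a b A' where A': "a < b" "A' \<in> events" "1 - \<Lambda> a < prob A'" "prob A' < 1 - \<Lambda> b"
    using not_constant_witness[OF assms(1)] by blast
  \<comment> \<open>\<open>A'\<close> serves for the lower bound at level \<open>\<Lambda> a\<close>
    and \<open>A\<close> for the upper bound at level \<open>\<Lambda> b\<close>; the gap between
    their probabilities leaves positive weight for the point mass.\<close>
  obtain A where A: "A \<in> events" "prob A' < prob A" "prob A < 1 - \<Lambda> b"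
    using exists_measure_between[OF assms(1) _ A'(4)] \<Lambda>[of b] by auto
  have b: "\<Lambda> b < 1" using A' measure_nonneg[of M A'] by linarith
  have P0: "0 < prob A'" using A'(3) \<Lambda>[of a] by auto
  have P1: "prob A < 1" using A(3) \<Lambda>[of b] by auto
  \<comment> \<open>Determined by equating the masses of the lower atom:
    \<open>1 - prob A = l * (1 - prob A')\<close>.\<close>
  define l where "l = (1 - prob A) / (1 - prob A')"
  have l: "0 < l" "l < 1" using A P1 by (auto simp: l_def)
  have "l * (1 - prob A') = 1 - prob A" using A P1 by (simp add: l_def)
  then have PA: "prob A = l * prob A' + (1 - l)" by (simp add: algebra_simps)
  \<comment> \<open>The second entry makes \<open>l * a + (1 - l) * N\<close> exceed
    \<open>b\<close>; the first makes \<open>d\<close> nonnegative.\<close>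
  define N where "N = max b ((b - l * a) / (1 - l) + 1)"
  have "(b - l * a) / (1 - l) < N" by (simp add: N_def)
  then have N: "b < l * a + (1 - l) * N" using l by (simp add: field_simps)
  have bN: "b \<le> N" by (simp add: N_def)
  define \<tau> where "\<tau> = 1 - (1 - prob A / (1 - \<Lambda> b)) / p"
  have "prob A / (1 - \<Lambda> b) < 1" using A b by simp
  then have \<tau>: "\<tau> < 1" using p by (simp add: \<tau>_def)
  \<comment> \<open>With this \<open>d\<close> the upper bound \<open>(N - d) + d * \<tau>\<close>
    for EVaR at level \<open>\<Lambda> b\<close> is exactly \<open>b\<close>.\<close>
  define d where "d = (N - b) / (1 - \<tau>)"
  have "d * (1 - \<tau>) = N - b" using \<tau> by (simp add: d_def)
  then have d: "(N - d) + d * \<tau> = b" by (simp add: algebra_simps)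
  have d0: "0 \<le> d" using \<tau> bN by (simp add: d_def)
  let ?X = "\<lambda>B \<omega>. (N - d) + d * indicator B \<omega> :: real"
  have XA: "ereal a \<le> Lambda_EVaR q M \<Lambda> (?X A')"
    using A' P0 bN by (intro Lambda_EVaR_affine_indicator_ge) auto
  have XS: "ereal N \<le> Lambda_EVaR q M \<Lambda> (?X (space M))"
    using \<Lambda>[of N] by (intro Lambda_EVaR_affine_indicator_ge) (auto simp: prob_space)
  have XB: "Lambda_EVaR q M \<Lambda> (?X A) \<le> ereal b"
    using A b d d0 by (intro Lambda_EVaR_affine_indicator_le) (auto simp: \<tau>_def)
  have Lp: "?X B \<in> Lp p M" and D: "distr M borel (?X B) \<in> compact_distributions" if "B \<in> events" for B
    using that p by (auto intro: affine_indicator_in_Lp distr_affine_indicator_compact)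
  have "ereal (l * a + (1 - l) * N) = ereal l * ereal a + ereal (1 - l) * ereal N" by simp
  also have "\<dots> \<le> ereal l * Lambda_EVaR q M \<Lambda> (?X A') + ereal (1 - l) * Lambda_EVaR q M \<Lambda> (?X (space M))"
    using l XA XS by (intro add_mono ereal_mult_left_mono) auto
  also have "\<dots> \<le> Lambda_EVaR q M \<Lambda> (?X A)"
    using concave[unfolded concave_in_mixtures_def, rule_format, OF D[OF A'(2)] D[OF sets.top] _ Lp[OF A'(2)] Lp[OF sets.top] Lp[OF A(1)] refl refl, of l]
      distr_affine_indicator_mixture[OF A(1) A'(2) _ PA, of "N - d" d] l by auto
  also have "\<dots> \<le> ereal b" by (rule XB)
  finally show False using N by simp
qed

end

end

theorem proposition3p5:
  fixes M :: "'a measure" and p :: real and q :: ereal and \<Lambda> :: "real \<Rightarrow> real"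
  assumes "prob_space M" and "atomless M"
    and "1 \<le> p" and "1 < q" and "1 / ereal p + 1 / q = 1"
    and "\<And>x. \<Lambda> x \<in> {0..1}" and "antimono \<Lambda>"
  shows "(convex_functional p M (Lambda_EVaR q M \<Lambda>)
            \<longleftrightarrow> concave_in_mixtures p M (Lambda_EVaR q M \<Lambda>)) \<and>
         (concave_in_mixtures p M (Lambda_EVaR q M \<Lambda>)
            \<longleftrightarrow> cash_additive p M (Lambda_EVaR q M \<Lambda>)) \<and>
         (cash_additive p M (Lambda_EVaR q M \<Lambda>) \<longleftrightarrow> (\<exists>c. \<forall>x. \<Lambda> x = c))"
proof -
  interpret prob_space M by fact
  \<comment> \<open>Constancy implies all three properties and follows from each of them, which
    yields every equivalence.\<close>
  have "convex_functional p M (Lambda_EVaR q M \<Lambda>) \<and> concave_in_mixtures p M (Lambda_EVaR q M \<Lambda>)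
      \<and> cash_additive p M (Lambda_EVaR q M \<Lambda>)" if const: "\<exists>c. \<forall>x. \<Lambda> x = c"
  proof -
    obtain c where c: "\<And>x. \<Lambda> x = c" using const by blast
    then have c01: "0 \<le> c" "c \<le> 1" using assms(6)[of 0] by simp_all
    have eq: "Lambda_EVaR q M \<Lambda> = EVaR q M c" by (rule ext) (rule Lambda_EVaR_const[OF c])
    show ?thesis unfolding eq
      using EVaR_convex[OF assms(3-5) _ _ c01] EVaR_concave_in_mixtures[OF assms(3-5) _ _ _ c01]
        EVaR_add_const[OF assms(3-5) _ c01]
      by (auto simp: convex_functional_def concave_in_mixtures_def cash_additive_def)
  qed
  then show ?thesis
    using convex_imp_constant[OF assms(3-7,2)] concave_in_mixtures_imp_constant[OF assms(3-7,2)]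
      cash_additive_imp_constant[OF assms(3-7,2)] by blast
qed

end
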